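(* Let $n\ge 3$, $0<\mu<n$, $s\in(0,1)$, and let $\Omega\subseteq\mathbb{R}^n$ be an arbitrary (non-empty) open set. Then the optimal constant $S_{H,L,M}(\Omega)$ is never achieved, i.e. there is no $u\in\Pi(\Omega)\setminus\{0\}$ with $\mathcal{G}(u)^2=S_{H,L,M}(\Omega)\,\|u\|_{HL}^2$.
   Context: Put $2_\mu^*=\frac{2n-\mu}{n-2}$ and $$\|u\|_{HL}=\left(\int_{\mathbb{R}^n}\int_{\mathbb{R}^n}\frac{|u(x)|^{2_\mu^*}|u(y)|^{2_\mu^*}}{|x-y|^\mu}\,dx\,dy\right)^{\frac{1}{2\cdot 2_\mu^*}} .$$ For measurable $u:\mathbb{R}^n\to\mathbb{R}$, $[u]_s^2=\frac{C(n,s)}{2}\int_{\mathbb{R}^n}\int_{\mathbb{R}^n}\frac{|u(x)-u(y)|^2}{|x-y|^{n+2s}}\,dx\,dy$, where $C(n,s)=\left(\int_{\mathbb{R}^n}\frac{1-\cos z_1}{|z|^{n+2s}}\,dz\right)^{-1}$. Put $\|u\|^2=\int_{\mathbb{R}^n}|\nabla u|^2dx$ and $\mathcal{G}(u)=\left(\|u\|^2+[u]_s^2\right)^{1/2}$. The space $\Pi(\Omega)$ is the completion of $C_0^\infty(\Omega)$ (functions extended by $0$ to $\mathbb{R}^n$) with respect to the norm $\mathcal{G}$; by the Sobolev inequality it is identified with a space of functions in $L^{2n/(n-2)}(\mathbb{R}^n)$ vanishing a.e. in $\mathbb{R}^n\setminus\Omega$. The constant is $$S_{H,L,M}(\Omega)=\inf_{u\in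 C_0^\infty(\Omega)\setminus\{0\}}\frac{\mathcal{G}(u)^2}{\|u\|_{HL}^2}.$$ *)

theory Defs
  imports "HOL-Analysis.Analysis"
begin

text \<open>
  The ambient space is \<open>real ^ 'n\<close>, so that \<open>n = CARD('n)\<close>.  All energies are integrals of nonnegative
  functions and are therefore taken as \<open>ennreal\<close>-valued integrals: a divergent integral is \<open>\<infinity>\<close>.
  Elements of Lebesgue and Sobolev spaces are represented by Borel functions; every a.e.-class of
  Lebesgue measurable functions has such a representative.
\<close>

text \<open>Real powers with positive exponent on \<open>[0,\<infinity>]\<close>.\<close>

definition epowr :: "ennreal \<Rightarrow> real \<Rightarrow> ennreal" where
  "epowr x p = (if x = \<infinity> then \<infinity> else ennreal (enn2real x powr p))"


subsection \<open>Test functions\<close>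

definition partial_deriv :: "'n::finite \<Rightarrow> (real ^ 'n \<Rightarrow> real) \<Rightarrow> real ^ 'n \<Rightarrow> real" where
  "partial_deriv i f x = frechet_derivative f (at x) (axis i 1)"

primrec Ck :: "nat \<Rightarrow> (real ^ 'n::finite \<Rightarrow> real) \<Rightarrow> bool" where
  "Ck 0 f \<longleftrightarrow> continuous_on UNIV f"
| "Ck (Suc k) f \<longleftrightarrow> (\<forall>x. f differentiable (at x)) \<and> (\<forall>i. Ck k (partial_deriv i f))"

definition smooth :: "(real ^ 'n::finite \<Rightarrow> real) \<Rightarrow> bool" where
  "smooth f \<longleftrightarrow> (\<forall>k. Ck k f)"

text \<open>\<open>C\<^sub>0\<^sup>\<infinity>(\<Omega>)\<close>, each function being extended by zero to the whole space.\<close>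

definition test_functions :: "(real ^ 'n::finite) set \<Rightarrow> (real ^ 'n \<Rightarrow> real) set" where
  "test_functions \<Omega> =
     {f. smooth f \<and> compact (closure {x. f x \<noteq> 0}) \<and> closure {x. f x \<noteq> 0} \<subseteq> \<Omega>}"


subsection \<open>Weak gradient and the two parts of the energy\<close>

definition locally_integrable ::
    "(real ^ 'n::finite \<Rightarrow> 'b::{banach, second_countable_topology}) \<Rightarrow> bool" where
  "locally_integrable f \<longleftrightarrow> (\<forall>K. compact K \<longrightarrow> set_integrable lborel K f)"

definition is_weak_gradient ::
    "(real ^ 'n::finite \<Rightarrow> real) \<Rightarrow> (real ^ 'n \<Rightarrow> real ^ 'n) \<Rightarrow> bool" where
  "is_weak_gradient u g \<longleftrightarrow> locally_integrable u \<and> locally_integrable g \<and>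
     (\<forall>\<phi>\<in>test_functions UNIV. \<forall>i.
        (LINT x|lborel. u x * partial_deriv i \<phi> x) = - (LINT x|lborel. g x $ i * \<phi> x))"

text \<open>
  A weak gradient is unique up to null sets, and it exists for test functions (where it is the
  classical gradient) and for all elements of the completion defined below.
\<close>

definition weak_gradient :: "(real ^ 'n::finite \<Rightarrow> real) \<Rightarrow> real ^ 'n \<Rightarrow> real ^ 'n" where
  "weak_gradient u = (SOME g. is_weak_gradient u g)"

definition dirichlet_sq :: "(real ^ 'n::finite \<Rightarrow> real) \<Rightarrow> ennreal" where
  "dirichlet_sq u = (\<integral>\<^sup>+x. ennreal ((norm (weak_gradient u x))\<^sup>2) \<partial>lborel)"

text \<open>
  The constant \<open>C(n,s)\<close>.  The index type carries no order, so the coordinate \<open>z\<^sub>1\<close> is read as an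
  arbitrarily chosen one; the integral is the same for every coordinate.
\<close>

definition frac_const :: "'n::finite itself \<Rightarrow> real \<Rightarrow> ennreal" where
  "frac_const _ s = inverse (\<integral>\<^sup>+z. ennreal ((1 - cos (z $ (SOME k::'n. True))) /
     norm z powr (real CARD('n) + 2 * s)) \<partial>(lborel :: (real ^ 'n) measure))"

text \<open>
  On the diagonal \<open>x = y\<close> division by zero makes the singular kernels here and below vanish; the
  diagonal is a null set.
\<close>

definition gagliardo_sq :: "real \<Rightarrow> (real ^ 'n::finite \<Rightarrow> real) \<Rightarrow> ennreal" where
  "gagliardo_sq s u = frac_const TYPE('n) s / 2 *
     (\<integral>\<^sup>+x. \<integral>\<^sup>+y. ennreal (\<bar>u x - u y\<bar>\<^sup>2 / norm (x - y) powr (real CARD('n) + 2 * s))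
        \<partial>lborel \<partial>lborel)"

definition G_norm :: "real \<Rightarrow> (real ^ 'n::finite \<Rightarrow> real) \<Rightarrow> ennreal" where
  "G_norm s u = epowr (dirichlet_sq u + gagliardo_sq s u) (1 / 2)"


subsection \<open>The Hardy--Littlewood--Sobolev norm\<close>

definition HL_exponent :: "'n::finite itself \<Rightarrow> real \<Rightarrow> real" where
  "HL_exponent _ \<mu> = (2 * real CARD('n) - \<mu>) / (real CARD('n) - 2)"

definition HL_norm :: "real \<Rightarrow> (real ^ 'n::finite \<Rightarrow> real) \<Rightarrow> ennreal" where
  "HL_norm \<mu> u = (let p = HL_exponent TYPE('n) \<mu> in
     epowr (\<integral>\<^sup>+x. \<integral>\<^sup>+y. ennreal (\<bar>u x\<bar> powr p * \<bar>u y\<bar> powr p / norm (x - y) powr \<mu>)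
              \<partial>lborel \<partial>lborel) (1 / (2 * p)))"


subsection \<open>The completion and the optimal constant\<close>

definition sobolev_exponent :: "'n::finite itself \<Rightarrow> real" where
  "sobolev_exponent _ = 2 * real CARD('n) / (real CARD('n) - 2)"

text \<open>
  By the Sobolev inequality a \<open>G_norm\<close>-Cauchy sequence of test functions converges in
  \<open>L\<^sup>q\<close> with \<open>q = 2n / (n - 2)\<close>, and the class of the sequence in the abstract completion is identified with its limit.
\<close>

definition Pi_space :: "real \<Rightarrow> (real ^ 'n::finite) set \<Rightarrow> (real ^ 'n \<Rightarrow> real) set" where
  "Pi_space s \<Omega> = {u. u \<in> borel_measurable borel \<and>
     (\<integral>\<^sup>+x. ennreal (\<bar>u x\<bar> powr sobolev_exponent TYPE('n)) \<partial>lborel) < \<infinity> \<and>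
     (\<exists>\<phi> :: nat \<Rightarrow> real ^ 'n \<Rightarrow> real. (\<forall>k. \<phi> k \<in> test_functions \<Omega>) \<and>
        (\<forall>\<epsilon>>0. \<exists>N. \<forall>j\<ge>N. \<forall>k\<ge>N. G_norm s (\<lambda>x. \<phi> j x - \<phi> k x) < \<epsilon>) \<and>
        (\<lambda>k. \<integral>\<^sup>+x. ennreal (\<bar>\<phi> k x - u x\<bar> powr sobolev_exponent TYPE('n)) \<partial>lborel)
          \<longlonglongrightarrow> 0)}"

definition S_HLM :: "real \<Rightarrow> real \<Rightarrow> (real ^ 'n::finite) set \<Rightarrow> ennreal" where
  "S_HLM \<mu> s \<Omega> = (INF u \<in> test_functions \<Omega> - {\<lambda>x. 0}. (G_norm s u)\<^sup>2 / (HL_norm \<mu> u)\<^sup>2)"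

end

theory Submission
  imports Defs "HOL-Computational_Algebra.Polynomial"
begin

text \<open>
Let \<open>D\<close> denote the Dirichlet energy \<open>dirichlet_sq\<close>, \<open>[\<cdot>]\<close> the Gagliardo seminorm and \<open>S\<close> the constant
\<open>S_HLM \<mu> s \<Omega>\<close>.  The two parts of the energy react differently to concentration.  Under
\<open>\<phi> \<mapsto> c powr ((n - 2) / 2) * \<phi> (c (x - x0))\<close> both \<open>D\<close> and the Hardy--Littlewood norm are
invariant, whereas the squared Gagliardo seminorm is multiplied by \<open>c powr (2 s - 2)\<close>, which tends to \<open>0\<close> as
\<open>c \<rightarrow> \<infinity>\<close>, because \<open>s < 1\<close>.  For large \<open>c\<close> the rescaled function is supported in a small ball around
\<open>x0 \<in> \<Omega>\<close>, hence is a competitor for \<open>S\<close>.  In the limit the nonlocal part disappears and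
\<open>S * HL(\<phi>)\<^sup>2 \<le> D(\<phi>)\<close> holds for every test function on the whole space
(\<open>S_HLM_le_dirichlet\<close>).

The inequality passes to every \<open>u\<close> in the completion.  The gradients of an approximating sequence
converge in \<open>L\<^sup>2\<close> to a function that must be the weak gradient of \<open>u\<close>
(\<open>weak_gradient_of_limit\<close>), so the Dirichlet energies converge to \<open>D(u)\<close>; along a subsequence that
converges almost everywhere, Fatou's lemma bounds the Hardy--Littlewood norm of \<open>u\<close>
(\<open>HL_norm_lower_semicontinuous\<close>).  An extremal \<open>u\<close> would therefore satisfy
\<open>D(u) + [u]\<^sup>2 = S * HL(u)\<^sup>2 \<le> D(u)\<close> with \<open>D(u)\<close> finite, so \<open>[u] = 0\<close>.  Then \<open>u\<close> is constant almost
everywhere, and the only constant in \<open>L\<^sup>q\<close> of the whole space is \<open>0\<close>.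

Three analytic facts stand behind this: uniqueness of weak gradients, for which smooth bumps
approximating indicators of boxes are built; completeness of \<open>L\<^sup>2\<close>; and integrability of the
kernel \<open>min 1 \<bar>z\<bar>\<^sup>2 / \<bar>z\<bar> powr (n + 2 s)\<close>, which gives \<open>0 < C(n,s) < \<infinity>\<close> and finite seminorms
of test functions.
\<close>

section \<open>Calculus of iterated partial derivatives\<close>

lemma partial_deriv_eqI:
  "(f has_derivative D) (at x) \<Longrightarrow> partial_deriv i f x = D (axis i 1)"
  unfolding partial_deriv_def by (metis frechet_derivative_at)

lemma partial_deriv_const: "partial_deriv i (\<lambda>x. c) = (\<lambda>x. 0)"
  by (rule ext, rule partial_deriv_eqI[where D = "\<lambda>_. 0"]) simp

lemma partial_deriv_add:
  assumes "\<forall>x. f differentiable (at x)" "\<forall>x. g differentiable (at x)"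
  shows "partial_deriv i (\<lambda>x. f x + g x) = (\<lambda>x. partial_deriv i f x + partial_deriv i g x)"
proof
  fix x
  obtain F G where "(f has_derivative F) (at x)" "(g has_derivative G) (at x)"
    using assms unfolding differentiable_def by blast
  note d = this
  show "partial_deriv i (\<lambda>x. f x + g x) x = partial_deriv i f x + partial_deriv i g x"
    by (simp add: partial_deriv_eqI[OF has_derivative_add[OF d]] partial_deriv_eqI[OF d(1)] partial_deriv_eqI[OF d(2)])
qed

lemma partial_deriv_mult:
  assumes "\<forall>x. f differentiable (at x)" "\<forall>x. g differentiable (at x)"
  shows "partial_deriv i (\<lambda>x. f x * g x) = (\<lambda>x. f x * partial_deriv i g x + partial_deriv i f x * g x)"
proof
  fix x
  obtain F G where "(f has_derivative F) (at x)" "(g has_derivative G) (at x)"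
    using assms unfolding differentiable_def by blast
  note d = this
  show "partial_deriv i (\<lambda>x. f x * g x) x = f x * partial_deriv i g x + partial_deriv i f x * g x"
    by (simp add: partial_deriv_eqI[OF has_derivative_mult[OF d]] partial_deriv_eqI[OF d(1)] partial_deriv_eqI[OF d(2)])
qed

lemma has_derivative_dilation:
  fixes f :: "real ^ 'n::finite \<Rightarrow> real"
  assumes "f differentiable (at (c *\<^sub>R (x - x0)))"
  shows "((\<lambda>x. a * f (c *\<^sub>R (x - x0))) has_derivative
           (\<lambda>v. a * frechet_derivative f (at (c *\<^sub>R (x - x0))) (c *\<^sub>R v))) (at x)"
proof -
  have "(f has_derivative frechet_derivative f (at (c *\<^sub>R (x - x0)))) (at (c *\<^sub>R (x - x0)))"
    using assms frechet_derivative_works by blast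
  moreover have "((\<lambda>x. c *\<^sub>R (x - x0)) has_derivative (\<lambda>v. c *\<^sub>R v)) (at x)"
    by (auto intro!: derivative_eq_intros)
  ultimately show ?thesis
    using diff_chain_at[of "\<lambda>x. c *\<^sub>R (x - x0)" "(\<lambda>v. c *\<^sub>R v)" x f]
    by (auto simp: o_def intro!: has_derivative_mult_right)
qed

lemma partial_deriv_dilation:
  fixes f :: "real ^ 'n::finite \<Rightarrow> real"
  assumes "\<forall>x. f differentiable (at x)"
  shows "partial_deriv i (\<lambda>x. a * f (c *\<^sub>R (x - x0))) = (\<lambda>x. (a * c) * partial_deriv i f (c *\<^sub>R (x - x0)))"
proof
  fix x
  have "linear (frechet_derivative f (at (c *\<^sub>R (x - x0))))"
    using assms frechet_derivative_works has_derivative_linear by blast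
  then show "partial_deriv i (\<lambda>x. a * f (c *\<^sub>R (x - x0))) x = (a * c) * partial_deriv i f (c *\<^sub>R (x - x0))"
    using assms
    by (subst partial_deriv_eqI[OF has_derivative_dilation])
       (simp_all only: partial_deriv_def linear_cmul real_scaleR_def ac_simps)
qed

text \<open>
Regularity of order \<open>k\<close> of a product involves the factors themselves next to their derivatives,
so the product rule below needs that the classes decrease with \<open>k\<close>.
\<close>

lemma Ck_lower: "Ck (Suc k) f \<Longrightarrow> Ck k f"
proof (induction k arbitrary: f)
  case 0
  then show ?case
    by (simp add: continuous_at_imp_continuous_on differentiable_imp_continuous_within)
qed (simp; blast)

lemma Ck_const: "Ck k (\<lambda>x. c)"
  by (induction k arbitrary: c) (simp_all add: partial_deriv_const)

lemma Ck_add: "Ck k f \<Longrightarrow> Ck k g \<Longrightarrow> Ck k (\<lambda>x. f x + g x)"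
proof (induction k arbitrary: f g)
  case 0
  then show ?case by (simp add: continuous_on_add)
next
  case (Suc k)
  then show ?case by (simp add: partial_deriv_add)
qed

lemma Ck_mult: "Ck k f \<Longrightarrow> Ck k g \<Longrightarrow> Ck k (\<lambda>x. f x * g x)"
proof (induction k arbitrary: f g)
  case 0
  then show ?case by (simp add: continuous_on_mult)
next
  case (Suc k)
  then have "Ck k f" "Ck k g" using Ck_lower by blast+
  with Suc show ?case by (simp add: partial_deriv_mult Ck_add)
qed

lemma Ck_prod: "finite A \<Longrightarrow> (\<And>a. a \<in> A \<Longrightarrow> Ck k (f a)) \<Longrightarrow> Ck k (\<lambda>x. \<Prod>a\<in>A. f a x)"
  by (induction A rule: finite_induct) (simp_all add: Ck_const Ck_mult)

lemma Ck_dilation: "Ck k f \<Longrightarrow> Ck k (\<lambda>x. a * f (c *\<^sub>R (x - x0)))"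
proof (induction k arbitrary: f a)
  case 0
  then show ?case
    by (auto intro!: continuous_intros continuous_on_compose2[of UNIV f])
next
  case (Suc k)
  then have d: "\<forall>x. f differentiable (at x)" by simp
  have "(\<lambda>x. a * f (c *\<^sub>R (x - x0))) differentiable (at x)" for x
    using has_derivative_dilation d differentiableI by blast
  then show ?case using Suc d by (simp add: partial_deriv_dilation)
qed

lemma smooth_differentiable: "smooth f \<Longrightarrow> f differentiable (at x)"
  unfolding smooth_def by (metis Ck.simps(2))

lemma smooth_partial_deriv: "smooth f \<Longrightarrow> smooth (partial_deriv i f)"
  unfolding smooth_def by (metis Ck.simps(2))

lemma smooth_continuous: "smooth f \<Longrightarrow> continuous_on UNIV f"
  unfolding smooth_def by (metis Ck.simps(1))

section \<open>Smooth bumps on boxes\<close>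

text \<open>
The functions \<open>P(1/t) exp(-1/t)\<close>, extended by \<open>0\<close> to \<open>t \<le> 0\<close>, with \<open>P\<close> a polynomial.  The polynomial
factor makes the family closed under differentiation, so that regularity of every order follows by
one induction over all of its members simultaneously.
\<close>

definition flat :: "real poly \<Rightarrow> real \<Rightarrow> real" where
  "flat P t = (if t > 0 then poly P (1 / t) * exp (- (1 / t)) else 0)"

text \<open>
With \<open>y = 1 / t\<close> this is the flatness of \<open>flat P\<close> at the origin.
\<close>

lemma poly_exp_minus_tendsto_0: "((\<lambda>y. poly P y * exp (- y)) \<longlongrightarrow> (0::real)) at_top"
proof -
  have "((\<lambda>y. \<Sum>i\<le>degree P. coeff P i * (y ^ i / exp y)) \<longlongrightarrow> (\<Sum>i\<le>degree P. coeff P i * 0)) at_top"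
    by (intro tendsto_intros tendsto_power_div_exp_0)
  then show ?thesis
    by (simp add: poly_altdef sum_distrib_right sum_divide_distrib exp_minus field_simps)
qed

text \<open>
For \<open>t > 0\<close> the chain rule gives the factor \<open>(P - P') (1/t) / t\<^sup>2\<close>, that is, the polynomial
\<open>X\<^sup>2 (P - P')\<close> evaluated at \<open>1/t\<close>.  At the origin the difference quotient is itself of the form \<open>flat\<close>, for
the polynomial \<open>X P\<close>, and tends to \<open>0\<close>.
\<close>

lemma flat_has_derivative:
  "(flat P has_real_derivative flat ([:0, 0, 1:] * (P - pderiv P)) t) (at t)"
proof -
  consider "t > 0" | "t < 0" | "t = 0" by linarith
  then show ?thesis
  proof cases
    case 1
    have "((\<lambda>t. poly P (1 / t) * exp (- (1 / t))) has_real_derivative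
            flat ([:0, 0, 1:] * (P - pderiv P)) t) (at t)"
      unfolding flat_def using 1
      by (auto intro!: derivative_eq_intros simp: power2_eq_square field_simps)
    then show ?thesis
      by (rule has_field_derivative_transform_within_open[where S = "{0<..}"])
         (use 1 in \<open>auto simp: flat_def\<close>)
  next
    case 2
    have "((\<lambda>t. 0) has_real_derivative flat ([:0, 0, 1:] * (P - pderiv P)) t) (at t)"
      using 2 by (simp add: flat_def)
    then show ?thesis
      by (rule has_field_derivative_transform_within_open[where S = "{..<0}"])
         (use 2 in \<open>auto simp: flat_def\<close>)
  next
    case 3
    have "((\<lambda>h. poly (pCons 0 P) (inverse h) * exp (- inverse h)) \<longlongrightarrow> 0) (at_right 0)"
      using poly_exp_minus_tendsto_0[of "pCons 0 P"]
      by (rule filterlim_compose[OF _ filterlim_inverse_at_top_right])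
    then have "((\<lambda>h. flat P h / h) \<longlongrightarrow> 0) (at_right 0)"
      by (rule Lim_transform_eventually)
         (auto simp: flat_def eventually_at_filter field_simps)
    moreover have "((\<lambda>h. flat P h / h) \<longlongrightarrow> 0) (at_left 0)"
      by (rule Lim_transform_eventually[OF tendsto_const])
         (auto simp: flat_def eventually_at_filter)
    ultimately have "((\<lambda>h. flat P h / h) \<longlongrightarrow> 0) (at 0)"
      by (simp add: filterlim_at_split)
    then show ?thesis using 3 by (simp add: DERIV_def flat_def)
  qed
qed

lemma flat_coordinate_has_derivative:
  fixes x :: "real ^ 'n::finite"
  shows "((\<lambda>x. a * flat P (c * x $ j + d)) has_derivative
     (\<lambda>v. a * (flat ([:0, 0, 1:] * (P - pderiv P)) (c * x $ j + d) * (c * v $ j)))) (at x)"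
proof -
  have "((\<lambda>x. c * x $ j + d) has_derivative (\<lambda>v. c * v $ j)) (at x)"
    by (auto intro!: derivative_eq_intros bounded_linear_imp_has_derivative bounded_linear_vec_nth)
  moreover have "(flat P has_derivative (\<lambda>h. flat ([:0, 0, 1:] * (P - pderiv P)) (c * x $ j + d) * h))
     (at (c * x $ j + d))"
    using flat_has_derivative has_field_derivative_def by blast
  ultimately show ?thesis
    using diff_chain_at[of "\<lambda>x. c * x $ j + d"]
    by (auto simp: o_def intro!: has_derivative_mult_right)
qed

lemma Ck_flat_coordinate: "Ck k (\<lambda>x :: real ^ 'n::finite. a * flat P (c * x $ j + d))"
proof (induction k arbitrary: a P)
  case 0
  show ?case
    using flat_coordinate_has_derivative has_derivative_continuous
    by (fastforce intro!: continuous_at_imp_continuous_on)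
next
  case (Suc k)
  have "partial_deriv i (\<lambda>x. a * flat P (c * x $ j + d)) =
     (\<lambda>x. (a * c * axis i 1 $ j) * flat ([:0, 0, 1:] * (P - pderiv P)) (c * x $ j + d))" for i
    by (rule ext, subst partial_deriv_eqI[OF flat_coordinate_has_derivative]) simp
  then show ?case
    using Suc flat_coordinate_has_derivative[of a P c j d] differentiableI by fastforce
qed

text \<open>
Each factor is \<open>exp(-1 / ((m + 1) t))\<close>, where \<open>t\<close> is the distance to one of the faces.  As \<open>m\<close> grows the
exponent tends to \<open>0\<close> inside the box, while outside one factor vanishes identically; so the bumps
tend pointwise to the indicator of the open box and stay between \<open>0\<close> and \<open>1\<close>.
\<close>

definition box_bump :: "real ^ 'n::finite \<Rightarrow> real ^ 'n \<Rightarrow> nat \<Rightarrow> real ^ 'n \<Rightarrow> real" where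
  "box_bump a b m x = (\<Prod>i\<in>UNIV. flat 1 (real (Suc m) * (x $ i - a $ i)) * flat 1 (real (Suc m) * (b $ i - x $ i)))"

lemma flat_1_bounds: "0 \<le> flat 1 t" "flat 1 t \<le> 1" "t \<le> 0 \<Longrightarrow> flat 1 t = 0"
  by (simp_all add: flat_def)

lemma box_bump_bounds: "0 \<le> box_bump a b m x" "box_bump a b m x \<le> 1"
  unfolding box_bump_def
  by (auto intro!: prod_nonneg prod_le_1 mult_le_one simp: flat_1_bounds)

lemma box_bump_eq_0:
  assumes "x \<notin> box a b"
  shows "box_bump a b m x = 0"
proof -
  obtain i where "x $ i - a $ i \<le> 0 \<or> b $ i - x $ i \<le> 0"
    using assms by (auto simp: mem_box_cart not_less)
  then have "flat 1 (real (Suc m) * (x $ i - a $ i)) = 0 \<or> flat 1 (real (Suc m) * (b $ i - x $ i)) = 0"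
    by (metis flat_1_bounds(3) mult_nonneg_nonpos of_nat_0_le_iff)
  then show ?thesis unfolding box_bump_def by (intro prod_zero) auto
qed

lemma smooth_box_bump: "smooth (box_bump a b m)"
proof -
  have "Ck k (\<lambda>x. flat 1 (real (Suc m) * (x $ i - a $ i)) * flat 1 (real (Suc m) * (b $ i - x $ i)))" for k i
    using Ck_mult[OF Ck_flat_coordinate[of k 1 1 "real (Suc m)" i "- real (Suc m) * a $ i"]
        Ck_flat_coordinate[of k 1 1 "- real (Suc m)" i "real (Suc m) * b $ i"]]
    by (simp add: algebra_simps)
  then show ?thesis
    unfolding smooth_def box_bump_def by (auto intro!: Ck_prod)
qed

lemma box_bump_test: "box_bump a b m \<in> test_functions UNIV"
proof -
  have "{x. box_bump a b m x \<noteq> 0} \<subseteq> cbox a b"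
    using box_bump_eq_0 box_subset_cbox by blast
  then have "bounded {x. box_bump a b m x \<noteq> 0}"
    using bounded_cbox bounded_subset by blast
  then show ?thesis
    unfolding test_functions_def using smooth_box_bump by (simp add: compact_closure)
qed

lemma box_bump_tendsto: "(\<lambda>m. box_bump a b m x) \<longlonglongrightarrow> indicator (box a b) x"
proof (cases "x \<in> box a b")
  case True
  have *: "(\<lambda>m. flat 1 (real (Suc m) * t)) \<longlonglongrightarrow> 1" if "t > 0" for t
  proof -
    have "(\<lambda>m. exp (- (1 / t) * inverse (real (Suc m)))) \<longlonglongrightarrow> exp (- (1/t) * 0)"
      by (intro tendsto_intros LIMSEQ_inverse_real_of_nat)
    moreover have "flat 1 (real (Suc m) * t) = exp (- (1 / t) * inverse (real (Suc m)))" for m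
      using that by (simp add: flat_def divide_inverse del: of_nat_Suc)
    ultimately show ?thesis by simp
  qed
  have "(\<lambda>m. box_bump a b m x) \<longlonglongrightarrow> (\<Prod>i\<in>(UNIV::'a set). 1 * 1)"
    unfolding box_bump_def using True
    by (intro tendsto_prod tendsto_mult *) (auto simp: mem_box_cart)
  then show ?thesis using True by simp
qed (simp add: box_bump_eq_0)

section \<open>Test functions\<close>

lemma test_functions_mono: "\<phi> \<in> test_functions \<Omega> \<Longrightarrow> \<phi> \<in> test_functions UNIV"
  unfolding test_functions_def by simp

lemma test_functionI:
  assumes "smooth f" "compact K" "K \<subseteq> \<Omega>" "\<And>x. x \<notin> K \<Longrightarrow> f x = 0"
  shows "f \<in> test_functions \<Omega>"
proof -
  have sub: "closure {x. f x \<noteq> 0} \<subseteq> K"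
    using assms compact_imp_closed by (intro closure_minimal) auto
  moreover have "bounded {x. f x \<noteq> 0}"
    using order_trans[OF closure_subset sub] bounded_subset[OF compact_imp_bounded[OF assms(2)]] by simp
  ultimately show ?thesis
    unfolding test_functions_def using assms by (auto simp: compact_closure)
qed

lemma test_functionE:
  assumes "f \<in> test_functions \<Omega>"
  obtains K where "smooth f" "compact K" "K \<subseteq> \<Omega>" "\<And>x. x \<notin> K \<Longrightarrow> f x = 0"
proof (rule that)
  show "smooth f" "compact (closure {x. f x \<noteq> 0})" "closure {x. f x \<noteq> 0} \<subseteq> \<Omega>"
    using assms by (auto simp: test_functions_def)
  show "f x = 0" if "x \<notin> closure {x. f x \<noteq> 0}" for x
    using that closure_subset[of "{x. f x \<noteq> 0}"] by auto
qed

lemma test_smooth: "\<phi> \<in> test_functions \<Omega> \<Longrightarrow> smooth \<phi>"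
  unfolding test_functions_def by simp

lemma test_borel: "\<phi> \<in> test_functions \<Omega> \<Longrightarrow> \<phi> \<in> borel_measurable borel"
  by (intro borel_measurable_continuous_onI smooth_continuous test_smooth)

lemma test_has_derivative:
  "\<phi> \<in> test_functions \<Omega> \<Longrightarrow> (\<phi> has_derivative frechet_derivative \<phi> (at x)) (at x)"
  using smooth_differentiable[OF test_smooth] frechet_derivative_works by blast

lemma test_diff:
  assumes "\<phi> \<in> test_functions \<Omega>" "\<psi> \<in> test_functions \<Omega>"
  shows "(\<lambda>x. \<phi> x - \<psi> x) \<in> test_functions \<Omega>"
proof -
  obtain K where K: "smooth \<phi>" "compact K" "K \<subseteq> \<Omega>" "\<And>x. x \<notin> K \<Longrightarrow> \<phi> x = 0"
    by (rule test_functionE[OF assms(1)]) (rule that)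
  obtain K' where K': "smooth \<psi>" "compact K'" "K' \<subseteq> \<Omega>" "\<And>x. x \<notin> K' \<Longrightarrow> \<psi> x = 0"
    by (rule test_functionE[OF assms(2)]) (rule that)
  have "Ck k (\<lambda>x. \<phi> x + (-1) * \<psi> x)" for k
    by (intro Ck_add Ck_mult Ck_const) (use K K' in \<open>auto simp: smooth_def\<close>)
  then have "smooth (\<lambda>x. \<phi> x - \<psi> x)" by (simp add: smooth_def)
  then show ?thesis
    using K K' by (intro test_functionI[of _ "K \<union> K'"]) auto
qed

lemma test_mult:
  assumes "\<phi> \<in> test_functions \<Omega>" "\<psi> \<in> test_functions \<Omega>"
  shows "(\<lambda>x. \<phi> x * \<psi> x) \<in> test_functions \<Omega>"
proof -
  obtain K where K: "smooth \<phi>" "compact K" "K \<subseteq> \<Omega>" "\<And>x. x \<notin> K \<Longrightarrow> \<phi> x = 0"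
    by (rule test_functionE[OF assms(1)]) (rule that)
  have "smooth (\<lambda>x. \<phi> x * \<psi> x)"
    using test_smooth[OF assms(1)] test_smooth[OF assms(2)] by (simp add: smooth_def Ck_mult)
  then show ?thesis
    using K by (intro test_functionI[of _ K]) auto
qed

lemma partial_deriv_diff:
  assumes "\<phi> \<in> test_functions \<Omega>" "\<psi> \<in> test_functions \<Omega>"
  shows "partial_deriv i (\<lambda>x. \<phi> x - \<psi> x) x = partial_deriv i \<phi> x - partial_deriv i \<psi> x"
  using partial_deriv_eqI[OF has_derivative_diff[OF test_has_derivative[OF assms(1)] test_has_derivative[OF assms(2)]]]
  by (simp add: partial_deriv_def)

lemma test_partial_deriv:
  assumes "\<phi> \<in> test_functions \<Omega>"
  shows "partial_deriv i \<phi> \<in> test_functions \<Omega>"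
proof -
  obtain K where K: "smooth \<phi>" "compact K" "K \<subseteq> \<Omega>" "\<And>x. x \<notin> K \<Longrightarrow> \<phi> x = 0"
    by (rule test_functionE[OF assms(1)]) (rule that)
  have "partial_deriv i \<phi> x = 0" if "x \<notin> K" for x
  proof -
    have "((\<lambda>x. 0) has_derivative (\<lambda>_. 0)) (at x)" by simp
    then have "(\<phi> has_derivative (\<lambda>_. 0)) (at x)"
      by (rule has_derivative_transform_within_open[where s = "- K"])
         (use K that compact_imp_closed in \<open>auto simp: open_Compl\<close>)
    then show ?thesis by (simp add: partial_deriv_eqI)
  qed
  then show ?thesis
    using K smooth_partial_deriv by (intro test_functionI[of _ K]) auto
qed

lemma test_bounded:
  assumes "\<phi> \<in> test_functions \<Omega>"
  obtains B K where "compact K" "0 \<le> B" "\<And>x. \<bar>\<phi> x\<bar> \<le> B * indicator K x"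
proof -
  obtain K where K: "smooth \<phi>" "compact K" "K \<subseteq> \<Omega>" "\<And>x. x \<notin> K \<Longrightarrow> \<phi> x = 0"
    by (rule test_functionE[OF assms(1)]) (rule that)
  have "continuous_on K \<phi>"
    using smooth_continuous[OF K(1)] continuous_on_subset by blast
  then have "bounded (\<phi> ` K)"
    using K(2) compact_continuous_image compact_imp_bounded by blast
  then obtain B where B: "\<And>x. x \<in> K \<Longrightarrow> \<bar>\<phi> x\<bar> \<le> B"
    unfolding bounded_iff by auto
  have "\<bar>\<phi> x\<bar> \<le> max B 0 * indicator K x" for x
    using K(4)[of x] B[of x] by (cases "x \<in> K") auto
  then show ?thesis using that[OF K(2), of "max B 0"] by simp
qed

lemma integrable_indicator_compact: "compact K \<Longrightarrow> integrable lborel (\<lambda>x. B * indicator K x :: real)"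
  using emeasure_compact_finite[of K] borel_compact[of K]
  by (intro integrable_mult_right integrable_real_indicator) auto

lemma test_integrable:
  assumes "\<phi> \<in> test_functions \<Omega>"
  shows "integrable lborel \<phi>"
proof -
  obtain B K where K: "compact K" "0 \<le> B" "\<And>x. \<bar>\<phi> x\<bar> \<le> B * indicator K x"
    by (rule test_bounded[OF assms]) (rule that)
  show ?thesis
  proof (rule Bochner_Integration.integrable_bound[OF integrable_indicator_compact[OF K(1), of B]])
    show "\<phi> \<in> borel_measurable lborel" using test_borel[OF assms] by simp
    show "AE x in lborel. norm (\<phi> x) \<le> norm (B * indicator K x :: real)"
      using K by (intro AE_I2) (simp add: abs_mult)
  qed
qed

text \<open>
The derivative is recovered from the partial derivatives by expanding \<open>v\<close> in the standard basis.
\<close>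

lemma norm_frechet_derivative_le:
  fixes \<phi> :: "real ^ 'n::finite \<Rightarrow> real"
  assumes "\<phi> \<in> test_functions \<Omega>"
  shows "\<bar>frechet_derivative \<phi> (at x) v\<bar> \<le> (\<Sum>i\<in>UNIV. \<bar>partial_deriv i \<phi> x\<bar>) * norm v"
proof -
  have lin: "linear (frechet_derivative \<phi> (at x))"
    using test_has_derivative[OF assms] has_derivative_linear by blast
  have "frechet_derivative \<phi> (at x) v = frechet_derivative \<phi> (at x) (\<Sum>i\<in>UNIV. (v $ i) *\<^sub>R axis i 1)"
    using basis_expansion[of v] by (simp add: scalar_mult_eq_scaleR)
  also have "\<dots> = (\<Sum>i\<in>UNIV. v $ i * partial_deriv i \<phi> x)"
    using lin by (simp add: linear_sum linear_cmul partial_deriv_def)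
  also have "\<bar>\<dots>\<bar> \<le> (\<Sum>i\<in>UNIV. norm v * \<bar>partial_deriv i \<phi> x\<bar>)"
    by (rule order_trans[OF sum_abs]) (auto simp: abs_mult intro!: sum_mono mult_right_mono component_le_norm_cart)
  finally show ?thesis by (simp add: sum_distrib_left mult.commute)
qed

text \<open>
The partial derivatives are test functions, hence bounded; the mean value theorem does the rest.
\<close>

lemma test_lipschitz:
  fixes \<phi> :: "real ^ 'n::finite \<Rightarrow> real"
  assumes "\<phi> \<in> test_functions \<Omega>"
  obtains L where "0 \<le> L" "\<And>x y. \<bar>\<phi> x - \<phi> y\<bar> \<le> L * norm (x - y)"
proof -
  have "\<exists>B\<ge>0. \<forall>x. \<bar>partial_deriv i \<phi> x\<bar> \<le> B" for i
  proof -
    obtain B K where K: "compact K" "0 \<le> B" "\<And>x. \<bar>partial_deriv i \<phi> x\<bar> \<le> B * indicator K x"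
      by (rule test_bounded[OF test_partial_deriv[OF assms]]) (rule that)
    have "\<bar>partial_deriv i \<phi> x\<bar> \<le> B" for x
      using K(2) K(3)[of x] by (cases "x \<in> K") auto
    then show ?thesis using K(2) by blast
  qed
  then obtain B where B: "\<And>i. B i \<ge> 0" "\<And>i x. \<bar>partial_deriv i \<phi> x\<bar> \<le> B i"
    by metis
  have "onorm (frechet_derivative \<phi> (at x)) \<le> (\<Sum>i\<in>UNIV. B i)" for x
  proof (rule onorm_le)
    fix v
    have "norm (frechet_derivative \<phi> (at x) v) \<le> (\<Sum>i\<in>UNIV. \<bar>partial_deriv i \<phi> x\<bar>) * norm v"
      using norm_frechet_derivative_le[OF assms] by simp
    also have "\<dots> \<le> (\<Sum>i\<in>UNIV. B i) * norm v"
      by (intro mult_right_mono sum_mono B) auto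
    finally show "norm (frechet_derivative \<phi> (at x) v) \<le> (\<Sum>i\<in>UNIV. B i) * norm v" .
  qed
  then have "norm (\<phi> x - \<phi> y) \<le> (\<Sum>i\<in>UNIV. B i) * norm (x - y)" for x y
    by (intro differentiable_bound[of UNIV \<phi>]) (use test_has_derivative[OF assms] in auto)
  then show ?thesis
    using that[of "\<Sum>i\<in>UNIV. B i"] B by (simp add: sum_nonneg)
qed

text \<open>
By translation invariance every difference quotient in direction \<open>i\<close> has integral \<open>0\<close>.  The quotients
are dominated by the Lipschitz constant on a ball that contains the support enlarged by \<open>1\<close>, so the
integral of their limit vanishes as well.
\<close>

lemma integral_partial_deriv_eq_0:
  fixes \<psi> :: "real ^ 'n::finite \<Rightarrow> real"
  assumes \<psi>: "\<psi> \<in> test_functions \<Omega>"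
  shows "(LINT x|lborel. partial_deriv i \<psi> x) = 0"
proof -
  define t where "t m = inverse (real (Suc m))" for m
  have t: "0 < t m" "t m \<le> 1" for m
    unfolding t_def by (simp_all add: inverse_le_1_iff)
  define q where "q m x = (\<psi> (t m *\<^sub>R axis i 1 + x) - \<psi> x) / t m" for m x
  obtain L where L: "0 \<le> L" "\<And>x y. \<bar>\<psi> x - \<psi> y\<bar> \<le> L * norm (x - y)"
    by (rule test_lipschitz[OF \<psi>]) (rule that)
  obtain K where K: "compact K" "\<And>x. x \<notin> K \<Longrightarrow> \<psi> x = 0"
    by (rule test_functionE[OF \<psi>]) (rule that)
  obtain R where R: "\<And>x. x \<in> K \<Longrightarrow> norm x \<le> R"
    using compact_imp_bounded[OF K(1)] unfolding bounded_iff by auto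
  note [measurable] = test_borel[OF \<psi>] test_borel[OF test_partial_deriv[OF \<psi>]]
  have shift: "integrable lborel (\<lambda>x. \<psi> (v + x))" "(LINT x|lborel. \<psi> (v + x)) = (LINT x|lborel. \<psi> x)" for v
  proof -
    have "integrable (distr lborel borel ((+) v)) \<psi>"
      using test_integrable[OF \<psi>] by (simp add: lborel_distr_plus)
    then show "integrable lborel (\<lambda>x. \<psi> (v + x))"
      by (subst (asm) integrable_distr_eq) auto
    have "(LINT x|lborel. \<psi> (v + x)) = (LINT x|distr lborel borel ((+) v). \<psi> x)"
      by (subst integral_distr) auto
    then show "(LINT x|lborel. \<psi> (v + x)) = (LINT x|lborel. \<psi> x)"
      by (simp add: lborel_distr_plus)
  qed
  have q0: "(LINT x|lborel. q m x) = 0" for m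
    unfolding q_def using shift test_integrable[OF \<psi>] by simp
  have "(\<lambda>m. LINT x|lborel. q m x) \<longlonglongrightarrow> (LINT x|lborel. partial_deriv i \<psi> x)"
  proof (rule integral_dominated_convergence)
    show "integrable lborel (\<lambda>x. L * indicator (cball 0 (R + 1)) x :: real)"
      by (intro integrable_indicator_compact compact_cball)
    show "AE x in lborel. (\<lambda>m. q m x) \<longlonglongrightarrow> partial_deriv i \<psi> x"
    proof (rule AE_I2)
      fix x :: "real ^ 'n"
      have "((\<lambda>s. s *\<^sub>R axis i 1 + x) has_derivative (\<lambda>s. s *\<^sub>R axis i 1)) (at 0)"
        by (auto intro!: derivative_eq_intros)
      moreover have "(\<psi> has_derivative frechet_derivative \<psi> (at x)) (at (0 *\<^sub>R axis i 1 + x))"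
        using test_has_derivative[OF \<psi>] by simp
      ultimately have "((\<lambda>s. \<psi> (s *\<^sub>R axis i 1 + x)) has_derivative
          (\<lambda>s. frechet_derivative \<psi> (at x) (s *\<^sub>R axis i 1))) (at 0)"
        by (rule diff_chain_at[unfolded o_def])
      moreover have "frechet_derivative \<psi> (at x) (s *\<^sub>R axis i 1) = partial_deriv i \<psi> x * s" for s
        using has_derivative_linear[OF test_has_derivative[OF \<psi>]]
        by (simp add: linear_cmul partial_deriv_def)
      ultimately have "((\<lambda>s. \<psi> (s *\<^sub>R axis i 1 + x)) has_real_derivative partial_deriv i \<psi> x) (at 0)"
        by (simp add: has_field_derivative_def)
      then have "((\<lambda>h. (\<psi> (h *\<^sub>R axis i 1 + x) - \<psi> x) / h) \<longlongrightarrow> partial_deriv i \<psi> x) (at 0)"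
        by (simp add: DERIV_def)
      moreover have "filterlim t (at 0) sequentially"
        unfolding filterlim_at
      proof
        show "eventually (\<lambda>m. t m \<in> UNIV \<and> t m \<noteq> 0) sequentially"
          using t(1) by (intro always_eventually) (simp add: less_imp_neq[symmetric])
        show "t \<longlonglongrightarrow> 0"
          unfolding t_def by (rule LIMSEQ_inverse_real_of_nat)
      qed
      ultimately show "(\<lambda>m. q m x) \<longlonglongrightarrow> partial_deriv i \<psi> x"
        unfolding q_def by (rule filterlim_compose)
    qed
    show "AE x in lborel. norm (q m x) \<le> L * indicator (cball 0 (R + 1)) x" for m
    proof (rule AE_I2)
      fix x
      show "norm (q m x) \<le> L * indicator (cball 0 (R + 1)) x"
      proof (cases "norm x \<le> R + 1")
        case True
        have "\<bar>\<psi> (t m *\<^sub>R axis i 1 + x) - \<psi> x\<bar> \<le> L * t m"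
          using L(2)[of "t m *\<^sub>R axis i 1 + x" x] t[of m] by simp
        then show ?thesis using True t[of m] by (simp add: q_def divide_simps)
      next
        case False
        have "norm x \<le> norm (t m *\<^sub>R axis i 1 + x) + t m"
          using norm_triangle_ineq4[of "t m *\<^sub>R axis i 1 + x" "t m *\<^sub>R axis i 1"] t[of m] by simp
        then have "t m *\<^sub>R axis i 1 + x \<notin> K" "x \<notin> K"
          using False t[of m] R[of x] R[of "t m *\<^sub>R axis i 1 + x"] by linarith+
        then show ?thesis by (simp add: q_def K L)
      qed
    qed
  qed (simp_all add: q_def)
  then show ?thesis using q0 by (simp add: LIMSEQ_const_iff)
qed

section \<open>Weak gradients\<close>

definition grad :: "(real ^ 'n::finite \<Rightarrow> real) \<Rightarrow> real ^ 'n \<Rightarrow> real ^ 'n" where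
  "grad f x = (\<chi> i. partial_deriv i f x)"

lemma continuous_grad: "smooth \<phi> \<Longrightarrow> continuous_on UNIV (grad \<phi>)"
  unfolding grad_def by (intro continuous_on_vec_lambda smooth_continuous smooth_partial_deriv)

lemma continuous_locally_integrable: "continuous_on UNIV f \<Longrightarrow> locally_integrable f"
  unfolding locally_integrable_def set_integrable_def
  by (auto intro: borel_integrable_compact continuous_on_subset)

text \<open>
Integration by parts: the derivative of the test function \<open>\<phi> \<psi>\<close> integrates to \<open>0\<close>.
\<close>

lemma grad_is_weak_gradient:
  assumes "\<phi> \<in> test_functions \<Omega>"
  shows "is_weak_gradient \<phi> (grad \<phi>)"
  unfolding is_weak_gradient_def
proof (intro conjI ballI allI)
  show "locally_integrable \<phi>" "locally_integrable (grad \<phi>)"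
    using assms by (auto intro!: continuous_locally_integrable continuous_grad smooth_continuous test_smooth)
  fix \<psi> :: "real ^ 'a \<Rightarrow> real" and i assume \<psi>: "\<psi> \<in> test_functions UNIV"
  have \<phi>: "\<phi> \<in> test_functions UNIV" using assms test_functions_mono by blast
  have "0 = (LINT x|lborel. partial_deriv i (\<lambda>x. \<phi> x * \<psi> x) x)"
    using integral_partial_deriv_eq_0[OF test_mult[OF \<phi> \<psi>]] by simp
  also have "\<dots> = (LINT x|lborel. \<phi> x * partial_deriv i \<psi> x + partial_deriv i \<phi> x * \<psi> x)"
    using smooth_differentiable[OF test_smooth[OF \<phi>]] smooth_differentiable[OF test_smooth[OF \<psi>]]
    by (subst partial_deriv_mult) auto
  also have "\<dots> = (LINT x|lborel. \<phi> x * partial_deriv i \<psi> x) + (LINT x|lborel. partial_deriv i \<phi> x * \<psi> x)"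
    using test_integrable[OF test_mult[OF \<phi> test_partial_deriv[OF \<psi>]]]
      test_integrable[OF test_mult[OF test_partial_deriv[OF \<phi>] \<psi>]]
    by (rule Bochner_Integration.integral_add)
  finally show "(LINT x|lborel. \<phi> x * partial_deriv i \<psi> x) = - (LINT x|lborel. grad \<phi> x $ i * \<psi> x)"
    by (simp add: grad_def)
qed

text \<open>
The Borel sets over which \<open>F\<close> integrates to \<open>0\<close> form a Dynkin system.  Complements belong to
it because the integral over the whole space vanishes, and it contains the boxes, which are stable
under intersection and generate the Borel sets.
\<close>

lemma AE_0_of_box_integrals:
  fixes F :: "'a::euclidean_space \<Rightarrow> real"
  assumes int: "integrable lborel F"
    and box: "\<And>a b. (LINT x:box a b|lborel. F x) = 0"
    and all: "(LINT x|lborel. F x) = 0"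
  shows "AE x in lborel. F x = 0"
proof -
  have si: "set_integrable lborel A F" if "A \<in> sets borel" for A
    using that int unfolding set_integrable_def by (intro integrable_mult_indicator) auto
  have "(LINT x:A|lborel. F x) = 0" if "A \<in> sets lborel" for A
  proof -
    have "Int_stable (range (\<lambda>(a, b). box a b :: 'a set))"
      by (auto simp: Int_stable_def box_Int_box)
    moreover have "range (\<lambda>(a, b). box a b :: 'a set) \<subseteq> Pow UNIV" by simp
    moreover have "A \<in> sigma_sets UNIV (range (\<lambda>(a, b). box a b :: 'a set))"
      using that by (simp add: borel_eq_box)
    ultimately show ?thesis
    proof (induction rule: sigma_sets_induct_disjoint)
      case (basic A)
      then show ?case using box by auto
    next
      case empty
      show ?case by (simp add: set_lebesgue_integral_def)
    next
      case (compl A)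
      then have A: "A \<in> sets borel" by (simp add: borel_eq_box)
      have "(LINT x:A \<union> (UNIV - A)|lborel. F x) = (LINT x:A|lborel. F x) + (LINT x:UNIV - A|lborel. F x)"
        using A by (intro set_integral_Un si) auto
      moreover have "A \<union> (UNIV - A) = UNIV" by auto
      ultimately show ?case using all compl by (simp add: set_lebesgue_integral_def)
    next
      case (union A)
      then have A: "A i \<in> sets borel" for i by (auto simp: borel_eq_box)
      have "(LINT x:(\<Union>i. A i)|lborel. F x) = (\<Sum>i. (LINT x:(A i)|lborel. F x))"
        using A union(1) by (intro lebesgue_integral_countable_add si) (auto simp: disjoint_family_on_def)
      then show ?case using union by simp
    qed
  qed
  then show ?thesis
    using density_unique_real[OF int, of "\<lambda>_. 0"] by (simp add: set_lebesgue_integral_def)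
qed

lemma locally_integrable_times_test:
  fixes f :: "real ^ 'n::finite \<Rightarrow> real"
  assumes f: "locally_integrable f" and \<psi>: "\<psi> \<in> test_functions \<Omega>"
  shows "integrable lborel (\<lambda>x. f x * \<psi> x)"
proof -
  obtain B K where K: "compact K" "0 \<le> B" and B: "\<And>x. \<bar>\<psi> x\<bar> \<le> B * indicator K x"
    by (rule test_bounded[OF \<psi>]) (rule that)
  have int: "integrable lborel (\<lambda>x. indicator K x *\<^sub>R f x)"
    using f K unfolding locally_integrable_def set_integrable_def by blast
  have eq: "f x * \<psi> x = (indicator K x *\<^sub>R f x) * \<psi> x" for x
    using B[of x] by (auto simp: indicator_def)
  have "integrable lborel (\<lambda>x. (indicator K x *\<^sub>R f x) * \<psi> x)"
  proof (rule Bochner_Integration.integrable_bound)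
    show "integrable lborel (\<lambda>x. B * (indicator K x *\<^sub>R f x))" using int by simp
    show "(\<lambda>x. (indicator K x *\<^sub>R f x) * \<psi> x) \<in> borel_measurable lborel"
      using borel_measurable_integrable[OF int] test_borel[OF \<psi>] by measurable
    show "AE x in lborel. norm (indicator K x *\<^sub>R f x * \<psi> x) \<le> norm (B * indicator K x *\<^sub>R f x)"
    proof (rule AE_I2)
      fix x
      have "\<bar>\<psi> x\<bar> * \<bar>f x\<bar> \<le> B * \<bar>f x\<bar>" if "x \<in> K"
        using B[of x] that by (intro mult_right_mono) auto
      then show "norm (indicator K x *\<^sub>R f x * \<psi> x) \<le> norm (B * indicator K x *\<^sub>R f x)"
        using K(2) by (cases "x \<in> K") (simp_all add: abs_mult mult.commute)
    qed
  qed
  then show ?thesis by (simp add: eq)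
qed

text \<open>
The fundamental lemma of the calculus of variations.  Testing against the bumps and passing to the
limit shows that \<open>f\<close> integrates to \<open>0\<close> over every box.  Since \<open>f\<close> is only locally integrable,
\<open>AE_0_of_box_integrals\<close> is applied to its restrictions to an exhausting sequence of boxes.
\<close>

lemma fundamental_lemma:
  fixes f :: "real ^ 'n::finite \<Rightarrow> real"
  assumes f: "locally_integrable f"
    and orth: "\<And>\<psi>. \<psi> \<in> test_functions UNIV \<Longrightarrow> (LINT x|lborel. f x * \<psi> x) = 0"
  shows "AE x in lborel. f x = 0"
proof -
  have int: "integrable lborel (\<lambda>x. indicator (cbox a b) x *\<^sub>R f x)" for a b
    using f compact_cbox[of a b] unfolding locally_integrable_def set_integrable_def by simp
  have box: "integrable lborel (\<lambda>x. indicator (box a b) x *\<^sub>R f x)"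
            "(LINT x|lborel. indicator (box a b) x *\<^sub>R f x) = 0" for a b
  proof -
    have eq: "indicator (box a b) x *\<^sub>R f x = indicator (box a b) x *\<^sub>R (indicator (cbox a b) x *\<^sub>R f x)" for x
      using subsetD[OF box_subset_cbox, of x a b] by (cases "x \<in> box a b") auto
    show i: "integrable lborel (\<lambda>x. indicator (box a b) x *\<^sub>R f x)"
      by (subst eq) (rule integrable_mult_indicator[OF _ int], simp)
    have "(\<lambda>m. LINT x|lborel. f x * box_bump a b m x) \<longlonglongrightarrow> (LINT x|lborel. indicator (box a b) x *\<^sub>R f x)"
    proof (rule integral_dominated_convergence)
      show "integrable lborel (\<lambda>x. norm (indicator (cbox a b) x *\<^sub>R f x))"
        using int by (rule integrable_norm)
      show "AE x in lborel. (\<lambda>m. f x * box_bump a b m x) \<longlonglongrightarrow> indicator (box a b) x *\<^sub>R f x"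
      proof (rule AE_I2)
        fix x
        show "(\<lambda>m. f x * box_bump a b m x) \<longlonglongrightarrow> indicator (box a b) x *\<^sub>R f x"
          using tendsto_mult_left[OF box_bump_tendsto[of a b x], of "f x"] by (simp add: mult.commute)
      qed
      show "AE x in lborel. norm (f x * box_bump a b m x) \<le> norm (indicator (cbox a b) x *\<^sub>R f x)" for m
      proof (rule AE_I2)
        fix x
        show "norm (f x * box_bump a b m x) \<le> norm (indicator (cbox a b) x *\<^sub>R f x)"
        proof (cases "x \<in> box a b")
          case True
          then have "x \<in> cbox a b" using box_subset_cbox by blast
          then show ?thesis
            using box_bump_bounds[of a b m x] by (simp add: abs_mult mult_left_le)
        qed (simp add: box_bump_eq_0)
      qed
      show "(\<lambda>x. indicator (box a b) x *\<^sub>R f x) \<in> borel_measurable lborel"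
        using i by (rule borel_measurable_integrable)
      show "(\<lambda>x. f x * box_bump a b m x) \<in> borel_measurable lborel" for m
        using locally_integrable_times_test[OF f box_bump_test] by (rule borel_measurable_integrable)
    qed
    then show "(LINT x|lborel. indicator (box a b) x *\<^sub>R f x) = 0"
      using orth[OF box_bump_test] by (simp add: LIMSEQ_const_iff)
  qed
  have "AE x in lborel. indicator (box (\<chi> i. - real N) (\<chi> i. real N)) x *\<^sub>R f x = 0" for N
  proof (rule AE_0_of_box_integrals)
    fix a b :: "real ^ 'n"
    obtain a' b' where ab: "box a b \<inter> box (\<chi> i. - real N) (\<chi> i. real N) = box a' b'"
      by (rule that) (rule box_Int_box)
    show "(LINT x:box a b|lborel. indicator (box (\<chi> i. - real N) (\<chi> i. real N)) x *\<^sub>R f x) = 0"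
      using box(2)[of a' b']
      by (simp add: set_lebesgue_integral_def ab[symmetric] indicator_inter_arith mult.assoc)
  qed (use box in auto)
  then have "AE x in lborel. \<forall>N. indicator (box (\<chi> i. - real N) (\<chi> i. real N)) x *\<^sub>R f x = 0"
    by (intro AE_all_countable[THEN iffD2] allI)
  then show ?thesis
  proof (rule AE_mp, intro AE_I2 impI)
    fix x :: "real ^ 'n"
    assume *: "\<forall>N. indicator (box (\<chi> i. - real N) (\<chi> i. real N)) x *\<^sub>R f x = 0"
    obtain N :: nat where "norm x < real N" using reals_Archimedean2 by blast
    then have "\<bar>x $ i\<bar> < real N" for i using component_le_norm_cart[of x i] by linarith
    then have "- real N < x $ i \<and> x $ i < real N" for i by (simp add: abs_less_iff minus_less_iff)
    then have "x \<in> box (\<chi> i. - real N) (\<chi> i. real N)"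
      by (simp add: mem_box_cart)
    then show "f x = 0" using *[rule_format, of N] by simp
  qed
qed

lemma locally_integrable_component:
  fixes h :: "real ^ 'n::finite \<Rightarrow> real ^ 'n"
  assumes "locally_integrable h"
  shows "locally_integrable (\<lambda>x. h x $ i)"
  unfolding locally_integrable_def set_integrable_def
proof (intro allI impI)
  fix K :: "(real ^ 'n) set" assume "compact K"
  then have "integrable lborel (\<lambda>x. indicator K x *\<^sub>R h x)"
    using assms unfolding locally_integrable_def set_integrable_def by simp
  from integrable_bounded_linear[OF bounded_linear_vec_nth this, of i]
  show "integrable lborel (\<lambda>x. indicator K x *\<^sub>R h x $ i)" by simp
qed

lemma weak_gradient_unique:
  assumes "is_weak_gradient u g" "is_weak_gradient u g'"
  shows "AE x in lborel. g x = g' x"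
proof -
  have "AE x in lborel. g x $ i - g' x $ i = 0" for i
  proof (rule fundamental_lemma)
    have l: "locally_integrable (\<lambda>x. g x $ i)" "locally_integrable (\<lambda>x. g' x $ i)"
      using assms by (simp_all add: locally_integrable_component is_weak_gradient_def)
    then show "locally_integrable (\<lambda>x. g x $ i - g' x $ i)"
      unfolding locally_integrable_def by (simp add: set_integral_diff)
    fix \<psi> :: "real ^ 'a \<Rightarrow> real" assume \<psi>: "\<psi> \<in> test_functions UNIV"
    have "(LINT x|lborel. g x $ i * \<psi> x) = (LINT x|lborel. g' x $ i * \<psi> x)"
      using assms \<psi> by (simp add: is_weak_gradient_def)
    then show "(LINT x|lborel. (g x $ i - g' x $ i) * \<psi> x) = 0"
      using locally_integrable_times_test[OF l(1) \<psi>] locally_integrable_times_test[OF l(2) \<psi>]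
      by (simp add: left_diff_distrib)
  qed
  then have "AE x in lborel. \<forall>i. g x $ i - g' x $ i = 0" by (simp add: AE_all_countable)
  then show ?thesis by (rule AE_mp) (auto simp: vec_eq_iff)
qed

text \<open>
Whatever weak gradient the choice operator in \<open>weak_gradient\<close> selects, it agrees almost everywhere
with any given one.
\<close>

lemma dirichlet_sq_eq:
  assumes "is_weak_gradient u g"
  shows "dirichlet_sq u = (\<integral>\<^sup>+x. ennreal ((norm (g x))\<^sup>2) \<partial>lborel)"
proof -
  have "is_weak_gradient u (weak_gradient u)"
    unfolding weak_gradient_def by (rule someI[of "is_weak_gradient u", OF assms])
  then have "AE x in lborel. weak_gradient u x = g x"
    using assms by (rule weak_gradient_unique)
  then show ?thesis unfolding dirichlet_sq_def by (intro nn_integral_cong_AE) auto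
qed

lemma dirichlet_sq_test:
  "\<phi> \<in> test_functions \<Omega> \<Longrightarrow> dirichlet_sq \<phi> = (\<integral>\<^sup>+x. ennreal ((norm (grad \<phi> x))\<^sup>2) \<partial>lborel)"
  by (intro dirichlet_sq_eq grad_is_weak_gradient)

section \<open>Dilations and the fractional kernel\<close>

lemma nn_integral_dilation:
  fixes f :: "'a::euclidean_space \<Rightarrow> ennreal"
  assumes [measurable]: "f \<in> borel_measurable borel" and c: "c \<noteq> 0"
  shows "(\<integral>\<^sup>+x. f x \<partial>lborel) = ennreal (\<bar>c\<bar> ^ DIM('a)) * (\<integral>\<^sup>+x. f (c *\<^sub>R (x - x0)) \<partial>lborel)"
proof -
  have "(\<integral>\<^sup>+x. f x \<partial>lborel) = ennreal (\<bar>c\<bar> ^ DIM('a)) * (\<integral>\<^sup>+x. f (- (c *\<^sub>R x0) + c *\<^sub>R x) \<partial>lborel)"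
    by (subst lborel_affine[OF c, of "- (c *\<^sub>R x0)"])
       (simp add: nn_integral_density nn_integral_distr nn_integral_cmult ennreal_power)
  then show ?thesis by (simp add: algebra_simps)
qed

lemma nn_integral_dilation2:
  fixes K :: "'a::euclidean_space \<Rightarrow> 'a \<Rightarrow> ennreal"
  assumes [measurable]: "(\<lambda>(x, y). K x y) \<in> borel_measurable (borel \<Otimes>\<^sub>M borel)" and c: "c > 0"
  shows "(\<integral>\<^sup>+x. \<integral>\<^sup>+y. K x y \<partial>lborel \<partial>lborel) =
    (\<integral>\<^sup>+x. \<integral>\<^sup>+y. ennreal (c ^ (2 * DIM('a))) * K (c *\<^sub>R (x - x0)) (c *\<^sub>R (y - x0)) \<partial>lborel \<partial>lborel)"
proof -
  have c': "c \<noteq> 0" using c by simp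
  have "(\<integral>\<^sup>+x. \<integral>\<^sup>+y. K x y \<partial>lborel \<partial>lborel) =
     (\<integral>\<^sup>+x. ennreal (c ^ DIM('a)) * (\<integral>\<^sup>+y. K x (c *\<^sub>R (y - x0)) \<partial>lborel) \<partial>lborel)"
    using c by (subst nn_integral_dilation[OF _ c', of "\<lambda>y. K _ y" x0]) (auto intro!: nn_integral_cong)
  also have "\<dots> = ennreal (c ^ DIM('a)) * (\<integral>\<^sup>+x. \<integral>\<^sup>+y. K x (c *\<^sub>R (y - x0)) \<partial>lborel \<partial>lborel)"
    by (intro nn_integral_cmult) measurable
  also have "(\<integral>\<^sup>+x. \<integral>\<^sup>+y. K x (c *\<^sub>R (y - x0)) \<partial>lborel \<partial>lborel) =
     ennreal (c ^ DIM('a)) * (\<integral>\<^sup>+x. \<integral>\<^sup>+y. K (c *\<^sub>R (x - x0)) (c *\<^sub>R (y - x0)) \<partial>lborel \<partial>lborel)"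
    using c by (subst nn_integral_dilation[OF _ c', of _ x0]) auto
  also have "ennreal (c ^ DIM('a)) * (ennreal (c ^ DIM('a)) *
      (\<integral>\<^sup>+x. \<integral>\<^sup>+y. K (c *\<^sub>R (x - x0)) (c *\<^sub>R (y - x0)) \<partial>lborel \<partial>lborel)) =
      ennreal (c ^ (2 * DIM('a))) * (\<integral>\<^sup>+x. \<integral>\<^sup>+y. K (c *\<^sub>R (x - x0)) (c *\<^sub>R (y - x0)) \<partial>lborel \<partial>lborel)"
    using c by (simp add: mult.assoc[symmetric] ennreal_mult[symmetric] power_add[symmetric] mult_2)
  also have "\<dots> = (\<integral>\<^sup>+x. ennreal (c ^ (2 * DIM('a))) * (\<integral>\<^sup>+y. K (c *\<^sub>R (x - x0)) (c *\<^sub>R (y - x0)) \<partial>lborel) \<partial>lborel)"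
    by (intro nn_integral_cmult[symmetric]) measurable
  also have "\<dots> = (\<integral>\<^sup>+x. \<integral>\<^sup>+y. ennreal (c ^ (2 * DIM('a))) * K (c *\<^sub>R (x - x0)) (c *\<^sub>R (y - x0)) \<partial>lborel \<partial>lborel)"
    by (intro nn_integral_cong nn_integral_cmult[symmetric]) measurable
  finally show ?thesis .
qed

text \<open>
Up to constants this kernel dominates the integrand of \<open>C(n,s)\<close>, since \<open>1 - cos t \<le> 2 min 1 t\<^sup>2\<close>, and
also the integrand of the seminorm of a bounded Lipschitz function.
\<close>

definition levy_kernel :: "real \<Rightarrow> real ^ 'n::finite \<Rightarrow> real" where
  "levy_kernel s z = min 1 ((norm z)\<^sup>2) / norm z powr (real CARD('n) + 2 * s)"

lemma levy_kernel_borel [measurable]: "levy_kernel s \<in> borel_measurable borel"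
  unfolding levy_kernel_def by measurable

lemma levy_kernel_nonneg: "0 \<le> levy_kernel s z"
  unfolding levy_kernel_def by simp

lemma dyadic_bracket:
  fixes t :: real
  assumes "1 \<le> t"
  obtains j :: nat where "2 powr real j \<le> t" "t \<le> 2 powr (real j + 1)"
proof
  have "0 \<le> log 2 t" using assms by simp
  then have j: "real (nat \<lfloor>log 2 t\<rfloor>) \<le> log 2 t" "log 2 t \<le> real (nat \<lfloor>log 2 t\<rfloor>) + 1"
    by linarith+
  show "2 powr real (nat \<lfloor>log 2 t\<rfloor>) \<le> t"
    by (rule le_log_iff[THEN iffD1, OF _ _ j(1)]) (use assms in auto)
  show "t \<le> 2 powr (real (nat \<lfloor>log 2 t\<rfloor>) + 1)"
    by (rule log_le_iff[THEN iffD1, OF _ _ j(2)]) (use assms in auto)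
qed

text \<open>
The \<open>j\<close>-th term integrates to a constant times \<open>2 powr (e j + n f j)\<close>, and the hypothesis makes this
a convergent geometric sequence.
\<close>

lemma nn_integral_dyadic_balls_finite:
  fixes e f :: "nat \<Rightarrow> real" and \<beta> \<gamma> :: real
  assumes exponents: "\<And>j. e j + real DIM('a) * f j = \<gamma> - \<beta> * real j" and \<beta>: "0 < \<beta>"
  shows "(\<integral>\<^sup>+z. (\<Sum>j. ennreal (2 powr e j) * indicator (cball 0 (2 powr f j)) (z::'a::euclidean_space)) \<partial>lborel) < \<infinity>"
proof -
  define V where "V = unit_ball_vol (real DIM('a))"
  have V: "V \<ge> 0" by (simp add: V_def)
  have "2 powr e j * (V * (2 powr f j) ^ DIM('a)) = (V * 2 powr \<gamma>) * (2 powr (-\<beta>)) ^ j" for j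
  proof -
    have "2 powr e j * (2 powr f j) ^ DIM('a) = 2 powr (e j + real DIM('a) * f j)"
      by (simp add: powr_add powr_realpow[symmetric] powr_powr mult.commute)
    also have "\<dots> = 2 powr \<gamma> * 2 powr (- \<beta> * real j)"
      by (simp add: exponents powr_add[symmetric])
    also have "2 powr (- \<beta> * real j) = (2 powr (-\<beta>)) ^ j"
      by (simp add: powr_realpow[symmetric] powr_powr)
    finally show ?thesis by (simp add: mult_ac)
  qed
  note term_eq = this
  have "(\<integral>\<^sup>+z. ennreal (2 powr e j) * indicator (cball 0 (2 powr f j)) (z::'a) \<partial>lborel)
      = ennreal ((V * 2 powr \<gamma>) * (2 powr (-\<beta>)) ^ j)" for j
  proof -
    have "(\<integral>\<^sup>+z. ennreal (2 powr e j) * indicator (cball 0 (2 powr f j)) (z::'a) \<partial>lborel)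
        = ennreal (2 powr e j) * emeasure lborel (cball (0::'a) (2 powr f j))"
      by (rule nn_integral_cmult_indicator) simp
    also have "\<dots> = ennreal (2 powr e j) * ennreal (V * (2 powr f j) ^ DIM('a))"
      unfolding V_def by (subst emeasure_cball) auto
    also have "\<dots> = ennreal (2 powr e j * (V * (2 powr f j) ^ DIM('a)))"
      using V by (intro ennreal_mult[symmetric]) auto
    finally show ?thesis unfolding term_eq .
  qed
  note term_int = this
  have "(\<integral>\<^sup>+z. (\<Sum>j. ennreal (2 powr e j) * indicator (cball 0 (2 powr f j)) (z::'a)) \<partial>lborel) =
       (\<Sum>j. (\<integral>\<^sup>+z. ennreal (2 powr e j) * indicator (cball 0 (2 powr f j)) (z::'a) \<partial>lborel))"
  proof (rule nn_integral_suminf)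
    show "(\<lambda>z. ennreal (2 powr e j) * indicator (cball 0 (2 powr f j)) (z::'a)) \<in> borel_measurable lborel" for j
      by (intro borel_measurable_times_ennreal borel_measurable_const borel_measurable_indicator) simp
  qed
  also have "\<dots> = (\<Sum>j. ennreal ((V * 2 powr \<gamma>) * (2 powr (-\<beta>)) ^ j))"
    by (simp only: term_int)
  also have "\<dots> = ennreal (\<Sum>j. (V * 2 powr \<gamma>) * (2 powr (-\<beta>)) ^ j)"
  proof (rule suminf_ennreal2)
    show "0 \<le> V * 2 powr \<gamma> * (2 powr - \<beta>) ^ j" for j using V by simp
    have "norm (2 powr - \<beta>) < 1" using \<beta> by (simp add: powr_less_one)
    then show "summable (\<lambda>j. V * 2 powr \<gamma> * (2 powr - \<beta>) ^ j)"
      by (intro summable_mult summable_geometric)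
  qed
  finally have "(\<integral>\<^sup>+z. (\<Sum>j. ennreal (2 powr e j) * indicator (cball 0 (2 powr f j)) (z::'a)) \<partial>lborel) =
      ennreal (\<Sum>j. (V * 2 powr \<gamma>) * (2 powr (-\<beta>)) ^ j)" .
  then show ?thesis by (simp only: ennreal_less_top infinity_ennreal_def)
qed

text \<open>
Dyadic decomposition.  For \<open>2\<^sup>j \<le> \<bar>z\<bar> \<le> 2\<^sup>j\<^sup>+\<^sup>1\<close> the kernel is at most \<open>2 powr (-j (n + 2 s))\<close>, and the shell
has volume of order \<open>2 powr (j n)\<close>; the product decays because \<open>s > 0\<close>.  Near the origin the extra factor
\<open>\<bar>z\<bar>\<^sup>2\<close> gives terms of order \<open>2 powr (-j (2 - 2 s))\<close>, which decay because \<open>s < 1\<close>.  Replacing shells by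
balls only changes constants.
\<close>

lemma nn_integral_levy_kernel_finite:
  assumes n: "2 \<le> CARD('n)" and s: "0 < s" "s < 1"
  shows "(\<integral>\<^sup>+z. ennreal (levy_kernel s (z :: real ^ 'n::finite)) \<partial>lborel) < \<infinity>"
proof -
  define d where "d = real CARD('n)"
  have d: "d \<ge> 2" using n by (simp add: d_def)
  define far where "far j z = ennreal (2 powr (- (d + 2 * s) * real j)) * indicator (cball 0 (2 powr (real j + 1))) z"
    for j and z :: "real ^ 'n"
  define near where "near j z = ennreal (2 powr ((d + 2 * s - 2) * (real j + 1))) * indicator (cball 0 (2 powr (- real j))) z"
    for j and z :: "real ^ 'n"
  have meas: "far j \<in> borel_measurable lborel" "near j \<in> borel_measurable lborel" for j
    unfolding far_def near_def
    by (intro borel_measurable_times_ennreal borel_measurable_const borel_measurable_indicator; simp)+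
  have meas_sum: "(\<lambda>z. \<Sum>j. far j z) \<in> borel_measurable lborel" "(\<lambda>z. \<Sum>j. near j z) \<in> borel_measurable lborel"
    by (intro borel_measurable_suminf_order meas)+
  have "ennreal (levy_kernel s z) \<le> (\<Sum>j. far j z) + (\<Sum>j. near j z)" for z :: "real ^ 'n"
  proof -
    have single: "g j \<le> (\<Sum>j. g j)" for g :: "nat \<Rightarrow> ennreal" and j
      using sum_le_suminf[OF summableI, of "{j}" g] by simp
    consider "z = 0" | "1 \<le> norm z" | "0 < norm z" "norm z < 1"
      by (metis not_le zero_less_norm_iff)
    then show ?thesis
    proof cases
      case 1
      then show ?thesis by (simp add: levy_kernel_def)
    next
      case 2
      then obtain j where j: "2 powr real j \<le> norm z" "norm z \<le> 2 powr (real j + 1)"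
        by (rule dyadic_bracket)
      have "1 \<le> (norm z)\<^sup>2" using 2 by simp
      then have "levy_kernel s z = norm z powr (- (d + 2 * s))"
        by (simp only: levy_kernel_def d_def powr_minus_divide min_absorb1)
      also have "\<dots> \<le> (2 powr real j) powr (- (d + 2 * s))"
        using j d s by (intro powr_mono2') auto
      finally have "ennreal (levy_kernel s z) \<le> far j z"
        using j by (simp add: far_def powr_powr mult.commute ennreal_leI)
      also have "\<dots> \<le> (\<Sum>j. far j z)" by (rule single)
      finally show ?thesis by (simp add: add_increasing2)
    next
      case 3
      then have "1 \<le> inverse (norm z)" by (simp add: one_le_inverse)
      then obtain j where j': "2 powr real j \<le> inverse (norm z)" "inverse (norm z) \<le> 2 powr (real j + 1)"
        by (rule dyadic_bracket)
      have j: "norm z \<le> 2 powr (- real j)" "2 powr (- (real j + 1)) \<le> norm z"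
        using le_imp_inverse_le[OF j'(1)] le_imp_inverse_le[OF j'(2)] 3 by (simp_all only: powr_minus) auto
      have "(norm z)\<^sup>2 \<le> 1" using 3 by (simp add: power_le_one)
      moreover have "(norm z)\<^sup>2 = norm z powr 2" using 3 by simp
      ultimately have "levy_kernel s z = norm z powr 2 / norm z powr (d + 2 * s)"
        by (simp only: levy_kernel_def d_def min_absorb2)
      also have "\<dots> = norm z powr (- (d + 2 * s - 2))"
        by (simp only: powr_diff[symmetric]) simp
      also have "\<dots> \<le> (2 powr (- (real j + 1))) powr (- (d + 2 * s - 2))"
        using j d s by (intro powr_mono2') auto
      also have "\<dots> = 2 powr ((d + 2 * s - 2) * (real j + 1))"
        by (simp only: powr_powr) (simp add: algebra_simps)
      finally have "ennreal (levy_kernel s z) \<le> near j z"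
        using j by (simp add: near_def ennreal_leI)
      also have "\<dots> \<le> (\<Sum>j. near j z)" by (rule single)
      finally show ?thesis by (simp add: add_increasing)
    qed
  qed
  then have "(\<integral>\<^sup>+z. ennreal (levy_kernel s (z :: real ^ 'n)) \<partial>lborel) \<le>
      (\<integral>\<^sup>+z. (\<Sum>j. far j z) + (\<Sum>j. near j z) \<partial>lborel)"
    by (intro nn_integral_mono)
  also have "\<dots> = (\<integral>\<^sup>+z. (\<Sum>j. far j z) \<partial>lborel) + (\<integral>\<^sup>+z. (\<Sum>j. near j z) \<partial>lborel)"
    by (rule nn_integral_add) (rule meas_sum)+
  also have "\<dots> < \<infinity>"
  proof -
    have "(\<integral>\<^sup>+z. (\<Sum>j. far j z) \<partial>lborel) < \<infinity>" unfolding far_def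
      by (rule nn_integral_dyadic_balls_finite[where \<beta> = "2 * s" and \<gamma> = d])
         (use s in \<open>simp_all add: d_def algebra_simps\<close>)
    moreover have "(\<integral>\<^sup>+z. (\<Sum>j. near j z) \<partial>lborel) < \<infinity>" unfolding near_def
      by (rule nn_integral_dyadic_balls_finite[where \<beta> = "2 - 2 * s" and \<gamma> = "d + 2 * s - 2"])
         (use s in \<open>simp_all add: d_def algebra_simps\<close>)
    ultimately show ?thesis by simp
  qed
  finally show ?thesis .
qed

lemma one_minus_cos_bounds: "0 \<le> 1 - cos t" "1 - cos t \<le> 2 * min 1 (t\<^sup>2)" for t :: real
proof -
  show "0 \<le> 1 - cos t" by simp
  have "1 - cos t = 2 * (sin (t / 2))\<^sup>2"
    using cos_double_sin[of "t / 2"] by simp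
  moreover have "(sin (t / 2))\<^sup>2 \<le> (t / 2)\<^sup>2"
    using abs_sin_x_le_abs_x[of "t / 2"] by (simp only: abs_le_square_iff)
  moreover have "(t / 2)\<^sup>2 \<le> t\<^sup>2" by (simp add: power2_eq_square)
  ultimately have "1 - cos t \<le> 2 * t\<^sup>2" by linarith
  moreover have "1 - cos t \<le> 2 * 1" using cos_ge_minus_one[of t] by linarith
  ultimately show "1 - cos t \<le> 2 * min 1 (t\<^sup>2)" by (cases "1 \<le> t\<^sup>2") (simp_all only: min_def if_True if_False)
qed

text \<open>
As an inverse in \<open>[0, \<infinity>]\<close> the constant could degenerate in two ways.  If it were \<open>0\<close>, the seminorm
would vanish identically and could not tell constants from other functions; if it were \<open>\<infinity>\<close>, nonzero
test functions would have infinite energy.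
\<close>

lemma frac_const_nondegenerate:
  assumes n: "2 \<le> CARD('n::finite)" and s: "0 < s" "s < 1"
  shows "frac_const TYPE('n) s \<noteq> 0" "frac_const TYPE('n) s \<noteq> \<infinity>"
proof -
  define k where "k = (SOME k::'n. True)"
  define h where "h z = (1 - cos (z $ k)) / norm z powr (real CARD('n) + 2 * s)" for z :: "real ^ 'n"
  have [measurable]: "h \<in> borel_measurable borel" unfolding h_def by measurable
  have h0: "0 \<le> h z" for z unfolding h_def by simp
  have "h z \<le> 2 * levy_kernel s z" for z
  proof -
    have "(z $ k)\<^sup>2 \<le> (norm z)\<^sup>2"
      using component_le_norm_cart[of z k] by (metis abs_le_square_iff abs_norm_cancel)
    then have "1 - cos (z $ k) \<le> 2 * min 1 ((norm z)\<^sup>2)"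
      using one_minus_cos_bounds(2)[of "z $ k"] by linarith
    then show ?thesis
      unfolding h_def levy_kernel_def by (simp add: divide_right_mono)
  qed
  then have "ennreal (h z) \<le> 2 * ennreal (levy_kernel s z)" for z
    using ennreal_leI[of "h z" "2 * levy_kernel s z"] by (simp add: ennreal_mult levy_kernel_nonneg)
  then have "(\<integral>\<^sup>+z. ennreal (h z) \<partial>lborel) \<le> (\<integral>\<^sup>+z. 2 * ennreal (levy_kernel s (z :: real ^ 'n)) \<partial>lborel)"
    by (intro nn_integral_mono)
  also have "\<dots> = 2 * (\<integral>\<^sup>+z. ennreal (levy_kernel s (z :: real ^ 'n)) \<partial>lborel)"
    by (rule nn_integral_cmult) simp
  also have "\<dots> < \<infinity>"
    using nn_integral_levy_kernel_finite[OF n s] by (simp add: ennreal_mult_less_top)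
  finally show "frac_const TYPE('n) s \<noteq> 0"
    unfolding frac_const_def h_def k_def by (simp add: ennreal_inverse_eq_0_iff)
  have "(\<integral>\<^sup>+z. ennreal (h z) \<partial>lborel) \<noteq> 0"
  proof
    assume "(\<integral>\<^sup>+z. ennreal (h z) \<partial>lborel) = 0"
    then have AE0: "AE z in lborel. h z = 0"
      using h0 by (simp add: nn_integral_0_iff_AE order.antisym)
    have nz: "h z \<noteq> 0" if "z \<in> box 0 (\<chi> i. 1)" for z
    proof -
      have z: "0 < z $ k" "z $ k < 1" using that by (auto simp: mem_box_cart)
      then have "cos (z $ k) < cos 0" using pi_gt3 by (intro cos_monotone_0_pi) auto
      moreover have "z \<noteq> 0" using z by auto
      ultimately show ?thesis by (simp add: h_def)
    qed
    have "AE z in lborel. z \<notin> box 0 ((\<chi> i. 1) :: real ^ 'n)"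
      by (rule AE_mp[OF AE0]) (use nz in auto)
    then have "emeasure lborel (box 0 (\<chi> i. 1) :: (real ^ 'n) set) = 0"
      by (subst (asm) AE_iff_measurable[OF _ refl]) auto
    moreover have "0 < (\<Prod>b\<in>Basis. ((\<chi> i. 1) :: real ^ 'n) \<bullet> b)"
      by (rule prod_pos) (auto simp: Basis_vec_def inner_axis)
    moreover have "0 \<le> ((\<chi> i. 1) :: real ^ 'n) \<bullet> b" if "b \<in> Basis" for b
      using that by (auto simp: Basis_vec_def inner_axis)
    ultimately show False
      by (simp add: emeasure_lborel_box_eq del: prod_zero_iff)
  qed
  then show "frac_const TYPE('n) s \<noteq> \<infinity>"
    unfolding frac_const_def h_def k_def by (simp add: ennreal_inverse_eq_top_iff)
qed

text \<open>
If \<open>\<bar>\<phi>\<bar> \<le> B\<close> and \<open>\<phi>\<close> has Lipschitz constant \<open>L\<close>, then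
\<open>\<bar>\<phi> x - \<phi> y\<bar>\<^sup>2 \<le> (L\<^sup>2 + 4 B\<^sup>2) min 1 \<bar>x - y\<bar>\<^sup>2\<close>, and the left side vanishes unless \<open>x\<close> or \<open>y\<close> lies in the
support.  Integrating the fractional kernel first in the other variable leaves the finite
measure of the support.
\<close>

lemma gagliardo_sq_test_finite:
  fixes \<phi> :: "real ^ 'n::finite \<Rightarrow> real"
  assumes n: "2 \<le> CARD('n)" and s: "0 < s" "s < 1" and \<phi>: "\<phi> \<in> test_functions \<Omega>"
  shows "gagliardo_sq s \<phi> < \<infinity>"
proof -
  obtain L where L: "0 \<le> L" "\<And>x y. \<bar>\<phi> x - \<phi> y\<bar> \<le> L * norm (x - y)"
    by (rule test_lipschitz[OF \<phi>]) (rule that)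
  obtain B K where K: "compact K" "0 \<le> B" "\<And>x. \<bar>\<phi> x\<bar> \<le> B * indicator K x"
    by (rule test_bounded[OF \<phi>]) (rule that)
  have [measurable]: "K \<in> sets borel" using K(1) by (rule borel_compact)
  define C where "C = L\<^sup>2 + (2 * B)\<^sup>2"
  have C0: "0 \<le> C" by (simp add: C_def)
  define M where "M = (\<integral>\<^sup>+z. ennreal (levy_kernel s (z :: real ^ 'n)) \<partial>lborel)"
  have M: "M < \<infinity>" unfolding M_def by (rule nn_integral_levy_kernel_finite[OF n s])
  have mass: "(\<integral>\<^sup>+y. ennreal (levy_kernel s (y - x)) \<partial>lborel) = M" for x :: "real ^ 'n"
    unfolding M_def by (subst nn_integral_dilation[of _ 1 x]) simp_all
  have sym: "levy_kernel s (x - y) = levy_kernel s (y - x)" for x y :: "real ^ 'n"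
    by (simp add: levy_kernel_def norm_minus_commute)
  have pt: "ennreal (\<bar>\<phi> x - \<phi> y\<bar>\<^sup>2 / norm (x - y) powr (real CARD('n) + 2 * s)) \<le>
        ennreal C * (ennreal (levy_kernel s (x - y)) * indicator K x + ennreal (levy_kernel s (x - y)) * indicator K y)" for x y
  proof (cases "x \<in> K \<or> y \<in> K")
    case True
    have "\<bar>\<phi> w\<bar> \<le> B" for w using K(2) K(3)[of w] by (cases "w \<in> K") auto
    from this[of x] this[of y]
    have "\<bar>\<phi> x - \<phi> y\<bar>\<^sup>2 \<le> (2 * B)\<^sup>2" by (intro power_mono) auto
    moreover have "\<bar>\<phi> x - \<phi> y\<bar>\<^sup>2 \<le> L\<^sup>2 * (norm (x - y))\<^sup>2"
      using power_mono[OF L(2)[of x y], of 2] by (simp add: power_mult_distrib)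
    moreover have "L\<^sup>2 * (norm (x - y))\<^sup>2 \<le> C * (norm (x - y))\<^sup>2"
      unfolding C_def by (intro mult_right_mono) auto
    ultimately have "\<bar>\<phi> x - \<phi> y\<bar>\<^sup>2 \<le> C * min 1 ((norm (x - y))\<^sup>2)"
      using zero_le_power2[of L] by (cases "1 \<le> (norm (x - y))\<^sup>2") (auto simp: C_def min_def intro: add_increasing)
    then have "\<bar>\<phi> x - \<phi> y\<bar>\<^sup>2 / norm (x - y) powr (real CARD('n) + 2 * s) \<le> C * levy_kernel s (x - y)"
      unfolding levy_kernel_def by (simp add: divide_right_mono)
    then have "ennreal (\<bar>\<phi> x - \<phi> y\<bar>\<^sup>2 / norm (x - y) powr (real CARD('n) + 2 * s)) \<le> ennreal C * ennreal (levy_kernel s (x - y))"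
      using ennreal_leI ennreal_mult[OF C0 levy_kernel_nonneg] by metis
    also have "\<dots> \<le> ennreal C * (ennreal (levy_kernel s (x - y)) * indicator K x + ennreal (levy_kernel s (x - y)) * indicator K y)"
      using True by (intro mult_left_mono) (auto simp: indicator_def)
    finally show ?thesis .
  next
    case False
    then have "\<phi> x = 0" "\<phi> y = 0" using K(3)[of x] K(3)[of y] by auto
    then show ?thesis by simp
  qed
  define Q where "Q x y = ennreal (levy_kernel s (x - y)) * indicator K x" for x y :: "real ^ 'n"
  define Q' where "Q' x y = ennreal (levy_kernel s (x - y)) * indicator K y" for x y :: "real ^ 'n"
  have [measurable]: "(\<lambda>(x, y). Q x y) \<in> borel_measurable (borel \<Otimes>\<^sub>M borel)" unfolding Q_def by measurable
  have [measurable]: "(\<lambda>(x, y). Q' x y) \<in> borel_measurable (borel \<Otimes>\<^sub>M borel)" unfolding Q'_def by measurable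
  have "(\<integral>\<^sup>+y. Q x y \<partial>lborel) = M * indicator K x" for x
  proof -
    have "(\<integral>\<^sup>+y. ennreal (levy_kernel s (x - y)) \<partial>lborel) = M"
      unfolding sym[of x] by (rule mass)
    then show ?thesis unfolding Q_def by (subst nn_integral_multc) auto
  qed
  then have 1: "(\<integral>\<^sup>+x. \<integral>\<^sup>+y. Q x y \<partial>lborel \<partial>lborel) = M * emeasure lborel K"
    by (simp add: nn_integral_cmult_indicator)
  have "(\<integral>\<^sup>+x. \<integral>\<^sup>+y. Q' x y \<partial>lborel \<partial>lborel) = (\<integral>\<^sup>+y. \<integral>\<^sup>+x. Q' x y \<partial>lborel \<partial>lborel)"
    by (rule lborel_pair.Fubini') measurable
  also have "\<dots> = M * emeasure lborel K"
    unfolding Q'_def by (simp add: nn_integral_multc mass nn_integral_cmult_indicator)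
  finally have 2: "(\<integral>\<^sup>+x. \<integral>\<^sup>+y. Q' x y \<partial>lborel \<partial>lborel) = M * emeasure lborel K" .
  have "(\<integral>\<^sup>+x. \<integral>\<^sup>+y. ennreal (\<bar>\<phi> x - \<phi> y\<bar>\<^sup>2 / norm (x - y) powr (real CARD('n) + 2 * s)) \<partial>lborel \<partial>lborel)
     \<le> (\<integral>\<^sup>+x. \<integral>\<^sup>+y. ennreal C * (Q x y + Q' x y) \<partial>lborel \<partial>lborel)"
    unfolding Q_def Q'_def by (intro nn_integral_mono pt)
  also have "\<dots> = ennreal C * (M * emeasure lborel K + M * emeasure lborel K)"
    by (simp add: nn_integral_cmult nn_integral_add 1 2)
  also have "\<dots> < \<infinity>"
    using M emeasure_compact_finite[OF K(1)] by (simp add: ennreal_mult_less_top)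
  finally have finite: "(\<integral>\<^sup>+x. \<integral>\<^sup>+y. ennreal (\<bar>\<phi> x - \<phi> y\<bar>\<^sup>2 / norm (x - y) powr (real CARD('n) + 2 * s)) \<partial>lborel \<partial>lborel) < \<infinity>" .
  have "frac_const TYPE('n) s / 2 \<noteq> top"
    using frac_const_nondegenerate(2)[OF n s] by (simp add: ennreal_divide_eq_top_iff)
  then have "frac_const TYPE('n) s / 2 < top" by (simp only: less_top)
  then show ?thesis
    unfolding gagliardo_sq_def using finite by (simp only: ennreal_mult_less_top infinity_ennreal_def) blast
qed

section \<open>Concentration removes the nonlocal energy\<close>

definition dilate :: "real \<Rightarrow> real ^ 'n::finite \<Rightarrow> (real ^ 'n \<Rightarrow> real) \<Rightarrow> real ^ 'n \<Rightarrow> real" where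
  "dilate c x0 u x = c powr ((real CARD('n) - 2) / 2) * u (c *\<^sub>R (x - x0))"

text \<open>
The support shrinks to the point \<open>x0\<close> at rate \<open>1/c\<close>.
\<close>

lemma dilate_test:
  fixes \<phi> :: "real ^ 'n::finite \<Rightarrow> real"
  assumes \<phi>: "\<phi> \<in> test_functions UNIV" and \<Omega>: "open \<Omega>" "x0 \<in> \<Omega>"
  shows "\<forall>\<^sub>F c in at_top. dilate c x0 \<phi> \<in> test_functions \<Omega>"
proof -
  obtain K where K: "compact K" "\<And>x. x \<notin> K \<Longrightarrow> \<phi> x = 0"
    by (rule test_functionE[OF \<phi>]) (rule that)
  obtain R where R: "0 < R" "\<And>x. x \<in> K \<Longrightarrow> norm x \<le> R"
    using compact_imp_bounded[OF K(1)] unfolding bounded_pos by blast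
  obtain r where r: "0 < r" "cball x0 r \<subseteq> \<Omega>"
    using \<Omega> open_contains_cball by blast
  have "dilate c x0 \<phi> \<in> test_functions \<Omega>" if c: "R / r \<le> c" for c
  proof (rule test_functionI[of _ "cball x0 r"])
    have "Ck k (dilate c x0 \<phi>)" for k
      using Ck_dilation[of k \<phi> "c powr ((real CARD('n) - 2) / 2)" c x0] test_smooth[OF \<phi>]
      by (simp add: smooth_def dilate_def[abs_def])
    then show "smooth (dilate c x0 \<phi>)" by (simp add: smooth_def)
    show "dilate c x0 \<phi> x = 0" if "x \<notin> cball x0 r" for x
    proof -
      have "0 < R / r" using r R by simp
      then have c0: "0 < c" using c by linarith
      have "R \<le> c * r" using c r by (simp add: field_simps)
      also have "c * r < c * norm (x - x0)"
        using that c0 by (simp add: dist_norm norm_minus_commute)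
      finally have "R < norm (c *\<^sub>R (x - x0))" using c0 by simp
      then have "c *\<^sub>R (x - x0) \<notin> K" using R(2) by fastforce
      then show ?thesis by (simp add: dilate_def K)
    qed
  qed (use r in auto)
  then show ?thesis by (auto simp: eventually_at_top_linorder)
qed

text \<open>
The squared gradient gains the factor \<open>c\<^sup>n\<close>, exactly the Jacobian of the dilation.
\<close>

lemma dirichlet_sq_dilate:
  fixes \<phi> :: "real ^ 'n::finite \<Rightarrow> real"
  assumes \<phi>: "\<phi> \<in> test_functions UNIV" and c: "0 < c" and d\<phi>: "dilate c x0 \<phi> \<in> test_functions \<Omega>"
  shows "dirichlet_sq (dilate c x0 \<phi>) = dirichlet_sq \<phi>"
proof -
  define a where "a = c powr ((real CARD('n) - 2) / 2)"
  have "a * c = c powr ((real CARD('n) - 2) / 2) * c powr 1" using c by (simp add: a_def)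
  also have "\<dots> = c powr (real CARD('n) / 2)"
    unfolding powr_add[symmetric] by (simp add: field_simps)
  finally have "(a * c)\<^sup>2 = c powr (real CARD('n) / 2 + real CARD('n) / 2)"
    by (simp only: power2_eq_square powr_add)
  then have ac: "(a * c)\<^sup>2 = c ^ CARD('n)"
    using c by (simp add: powr_realpow)
  have "grad (dilate c x0 \<phi>) x = (a * c) *\<^sub>R grad \<phi> (c *\<^sub>R (x - x0))" for x
    using partial_deriv_dilation[of \<phi> _ a c x0] smooth_differentiable[OF test_smooth[OF \<phi>]]
    by (simp add: grad_def vec_eq_iff dilate_def[abs_def] a_def)
  then have g: "(norm (grad (dilate c x0 \<phi>) x))\<^sup>2 = c ^ CARD('n) * (norm (grad \<phi> (c *\<^sub>R (x - x0))))\<^sup>2" for x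
    by (simp add: power_mult_distrib ac[symmetric])
  have [measurable]: "grad \<phi> \<in> borel_measurable borel"
    by (intro borel_measurable_continuous_onI continuous_grad test_smooth[OF \<phi>])
  have "(\<integral>\<^sup>+x. ennreal ((norm (grad \<phi> x))\<^sup>2) \<partial>lborel) =
      ennreal (\<bar>c\<bar> ^ DIM(real ^ 'n)) * (\<integral>\<^sup>+x. ennreal ((norm (grad \<phi> (c *\<^sub>R (x - x0))))\<^sup>2) \<partial>lborel)"
    using c by (intro nn_integral_dilation) simp_all
  also have "\<dots> = (\<integral>\<^sup>+x. ennreal (c ^ CARD('n)) * ennreal ((norm (grad \<phi> (c *\<^sub>R (x - x0))))\<^sup>2) \<partial>lborel)"
    using c by (subst nn_integral_cmult) simp_all
  also have "\<dots> = (\<integral>\<^sup>+x. ennreal ((norm (grad (dilate c x0 \<phi>) x))\<^sup>2) \<partial>lborel)"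
    using c by (simp add: g ennreal_mult)
  finally show ?thesis using dirichlet_sq_test[OF \<phi>] dirichlet_sq_test[OF d\<phi>] by simp
qed

text \<open>
The factor \<open>c powr (n - 2)\<close> from the amplitude and \<open>c powr (n + 2 s)\<close> from the kernel are divided by the
Jacobian \<open>c powr (2 n)\<close> of the double integral.
\<close>

lemma gagliardo_sq_dilate:
  fixes u :: "real ^ 'n::finite \<Rightarrow> real"
  assumes [measurable]: "u \<in> borel_measurable borel" and c: "0 < c"
  shows "gagliardo_sq s (dilate c x0 u) = ennreal (c powr (2 * s - 2)) * gagliardo_sq s u"
proof -
  define n where "n = real CARD('n)"
  define K where "K x y = ennreal (\<bar>u x - u y\<bar>\<^sup>2 / norm (x - y) powr (n + 2 * s))" for x y
  define b where "b = c powr (2 * s - 2)"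
  have [measurable]: "(\<lambda>(x, y). K x y) \<in> borel_measurable (borel \<Otimes>\<^sub>M borel)"
    unfolding K_def by measurable
  have pt: "ennreal (\<bar>dilate c x0 u x - dilate c x0 u y\<bar>\<^sup>2 / norm (x - y) powr (n + 2 * s)) =
      ennreal b * (ennreal (c ^ (2 * DIM(real ^ 'n))) * K (c *\<^sub>R (x - x0)) (c *\<^sub>R (y - x0)))" for x y
  proof -
    define U where "U = \<bar>u (c *\<^sub>R (x - x0)) - u (c *\<^sub>R (y - x0))\<bar>"
    have "\<bar>dilate c x0 u x - dilate c x0 u y\<bar> = c powr ((n - 2) / 2) * U"
      by (simp add: dilate_def n_def U_def abs_mult flip: right_diff_distrib)
    moreover have "(c powr ((n - 2) / 2))\<^sup>2 = c powr (n - 2)"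
      using c by (simp add: power2_eq_square flip: powr_add)
    ultimately have 1: "\<bar>dilate c x0 u x - dilate c x0 u y\<bar>\<^sup>2 = c powr (n - 2) * U\<^sup>2"
      by (simp only: power_mult_distrib)
    have "c *\<^sub>R (x - x0) - c *\<^sub>R (y - x0) = c *\<^sub>R (x - y)" by (simp add: algebra_simps)
    then have 2: "norm (c *\<^sub>R (x - x0) - c *\<^sub>R (y - x0)) powr (n + 2 * s) = c powr (n + 2 * s) * norm (x - y) powr (n + 2 * s)"
      using c by (simp add: powr_mult)
    have "c powr (n - 2) * c powr (n + 2 * s) = b * c powr (2 * n)"
      by (simp add: b_def add.commute flip: powr_add)
    also have "c powr (2 * n) = c ^ (2 * DIM(real ^ 'n))"
      using c by (simp add: n_def flip: powr_realpow)
    finally have 3: "c powr (n - 2) = b * c ^ (2 * DIM(real ^ 'n)) / c powr (n + 2 * s)"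
      using c by (simp add: field_simps)
    have "\<bar>dilate c x0 u x - dilate c x0 u y\<bar>\<^sup>2 / norm (x - y) powr (n + 2 * s) =
       b * (c ^ (2 * DIM(real ^ 'n)) * (U\<^sup>2 / norm (c *\<^sub>R (x - x0) - c *\<^sub>R (y - x0)) powr (n + 2 * s)))"
      unfolding 1 2 3 by simp
    then show ?thesis
      unfolding K_def U_def using c by (simp add: b_def ennreal_mult[symmetric])
  qed
  have "(\<integral>\<^sup>+x. \<integral>\<^sup>+y. ennreal (\<bar>dilate c x0 u x - dilate c x0 u y\<bar>\<^sup>2 / norm (x - y) powr (n + 2 * s)) \<partial>lborel \<partial>lborel)
      = (\<integral>\<^sup>+x. ennreal b * (\<integral>\<^sup>+y. ennreal (c ^ (2 * DIM(real ^ 'n))) * K (c *\<^sub>R (x - x0)) (c *\<^sub>R (y - x0)) \<partial>lborel) \<partial>lborel)"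
    unfolding pt by (intro nn_integral_cong nn_integral_cmult) measurable
  also have "\<dots> = ennreal b * (\<integral>\<^sup>+x. \<integral>\<^sup>+y. ennreal (c ^ (2 * DIM(real ^ 'n))) * K (c *\<^sub>R (x - x0)) (c *\<^sub>R (y - x0)) \<partial>lborel \<partial>lborel)"
    by (intro nn_integral_cmult) measurable
  also have "\<dots> = ennreal b * (\<integral>\<^sup>+x. \<integral>\<^sup>+y. K x y \<partial>lborel \<partial>lborel)"
    using c by (subst nn_integral_dilation2[of K c x0]) simp_all
  finally show ?thesis
    unfolding gagliardo_sq_def K_def n_def b_def by (simp add: mult_ac)
qed

text \<open>
The exponent \<open>p\<close> satisfies \<open>(n - 2) p = 2 n - \<mu>\<close>: the amplitude contributes \<open>c powr (2 n - \<mu>)\<close> and the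
kernel \<open>c powr \<mu>\<close>, which together cancel the Jacobian \<open>c powr (2 n)\<close>.
\<close>

lemma HL_norm_dilate:
  fixes u :: "real ^ 'n::finite \<Rightarrow> real"
  assumes n3: "3 \<le> CARD('n)" and [measurable]: "u \<in> borel_measurable borel" and c: "0 < c"
  shows "HL_norm \<mu> (dilate c x0 u) = HL_norm \<mu> u"
proof -
  define n where "n = real CARD('n)"
  define p where "p = HL_exponent TYPE('n) \<mu>"
  define K where "K x y = ennreal (\<bar>u x\<bar> powr p * \<bar>u y\<bar> powr p / norm (x - y) powr \<mu>)" for x y
  have [measurable]: "(\<lambda>(x, y). K x y) \<in> borel_measurable (borel \<Otimes>\<^sub>M borel)"
    unfolding K_def by measurable
  have n2: "n - 2 \<noteq> 0" using n3 by (simp add: n_def)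
  have pt: "ennreal (\<bar>dilate c x0 u x\<bar> powr p * \<bar>dilate c x0 u y\<bar> powr p / norm (x - y) powr \<mu>) =
      ennreal (c ^ (2 * DIM(real ^ 'n))) * K (c *\<^sub>R (x - x0)) (c *\<^sub>R (y - x0))" for x y
  proof -
    have "(n - 2) * p = 2 * n - \<mu>"
      using n2 unfolding p_def HL_exponent_def n_def[symmetric] by simp
    then have "(n - 2) / 2 * p = (2 * n - \<mu>) / 2" by simp
    then have 1: "\<bar>dilate c x0 u z\<bar> powr p = c powr ((2 * n - \<mu>) / 2) * \<bar>u (c *\<^sub>R (z - x0))\<bar> powr p" for z
      by (simp add: dilate_def n_def abs_mult powr_mult powr_powr)
    have "c *\<^sub>R (x - x0) - c *\<^sub>R (y - x0) = c *\<^sub>R (x - y)" by (simp add: algebra_simps)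
    then have 2: "norm (c *\<^sub>R (x - x0) - c *\<^sub>R (y - x0)) powr \<mu> = c powr \<mu> * norm (x - y) powr \<mu>"
      using c by (simp add: powr_mult)
    have "c powr ((2 * n - \<mu>) / 2) * c powr ((2 * n - \<mu>) / 2) * c powr \<mu> = c powr (2 * n)"
      by (simp add: field_simps flip: powr_add)
    also have "c powr (2 * n) = c ^ (2 * DIM(real ^ 'n))"
      using c by (simp add: n_def flip: powr_realpow)
    finally have 3: "c ^ (2 * DIM(real ^ 'n)) = c powr ((2 * n - \<mu>) / 2) * c powr ((2 * n - \<mu>) / 2) * c powr \<mu>" ..
    have "\<bar>dilate c x0 u x\<bar> powr p * \<bar>dilate c x0 u y\<bar> powr p / norm (x - y) powr \<mu> =
      c ^ (2 * DIM(real ^ 'n)) * (\<bar>u (c *\<^sub>R (x - x0))\<bar> powr p * \<bar>u (c *\<^sub>R (y - x0))\<bar> powr p /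
        norm (c *\<^sub>R (x - x0) - c *\<^sub>R (y - x0)) powr \<mu>)"
      unfolding 1 2 3 using c by (simp add: field_simps)
    then show ?thesis
      unfolding K_def using c by (simp add: ennreal_mult[symmetric])
  qed
  have "(\<integral>\<^sup>+x. \<integral>\<^sup>+y. ennreal (\<bar>dilate c x0 u x\<bar> powr p * \<bar>dilate c x0 u y\<bar> powr p / norm (x - y) powr \<mu>) \<partial>lborel \<partial>lborel)
      = (\<integral>\<^sup>+x. \<integral>\<^sup>+y. K x y \<partial>lborel \<partial>lborel)"
    unfolding pt using c by (subst nn_integral_dilation2[of K c x0]) simp_all
  then show ?thesis
    unfolding HL_norm_def K_def p_def by (simp add: Let_def)
qed

lemma epowr_half_squared: "(epowr x (1 / 2))\<^sup>2 = x"
proof (cases x)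
  case (real r)
  then show ?thesis
    by (simp add: epowr_def ennreal_power powr_half_sqrt)
qed (simp add: epowr_def power2_eq_square)

lemma G_norm_squared: "(G_norm s u)\<^sup>2 = dirichlet_sq u + gagliardo_sq s u"
  unfolding G_norm_def by (rule epowr_half_squared)

lemma HL_norm_zero: 
  assumes "0 < HL_exponent TYPE('n) \<mu>"
  shows "HL_norm \<mu> (\<lambda>x :: real ^ 'n::finite. 0) = 0"
  using assms by (simp add: HL_norm_def Let_def epowr_def)

text \<open>
For \<open>b \<in> {0, \<infinity>}\<close> the left side is \<open>0\<close>; otherwise the two sides agree.  This clears the
denominator in the quotient that defines the optimal constant.
\<close>

lemma ennreal_divide_times_le: "a / b * b \<le> (a::ennreal)"
proof -
  consider "b = 0" | "b = \<infinity>" | "b \<noteq> 0" "b \<noteq> \<infinity>" by blast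
  then show ?thesis
  proof cases
    case 2
    then show ?thesis by (simp add: divide_ennreal_def)
  next
    case 3
    then show ?thesis
      by (simp add: ennreal_divide_times ennreal_divide_self ennreal_times_divide less_top mult_divide_eq_ennreal)
  qed simp
qed

text \<open>
Dilates of \<open>\<phi>\<close> concentrated at a point of \<open>\<Omega>\<close> compete for the constant.  Their energy is
\<open>D(\<phi>) + c powr (2 s - 2) [\<phi>]\<^sup>2\<close> and their Hardy--Littlewood norm that of \<open>\<phi>\<close>; letting \<open>c \<rightarrow> \<infinity>\<close> leaves the
Dirichlet energy alone.
\<close>

lemma S_HLM_le_dirichlet:
  fixes \<phi> :: "real ^ 'n::finite \<Rightarrow> real" and \<Omega> :: "(real ^ 'n) set"
  assumes n3: "3 \<le> CARD('n)" and s: "0 < s" "s < 1" and \<mu>: "\<mu> < real CARD('n)"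
    and \<Omega>: "open \<Omega>" "\<Omega> \<noteq> {}" and \<phi>: "\<phi> \<in> test_functions UNIV"
  shows "S_HLM \<mu> s \<Omega> * (HL_norm \<mu> \<phi>)\<^sup>2 \<le> dirichlet_sq \<phi>"
proof (cases "\<phi> = (\<lambda>x. 0)")
  case True
  have "0 < HL_exponent TYPE('n) \<mu>"
    using n3 \<mu> by (simp add: HL_exponent_def)
  then show ?thesis by (simp add: True HL_norm_zero)
next
  case False
  then obtain z where z: "\<phi> z \<noteq> 0" by auto
  obtain x0 where x0: "x0 \<in> \<Omega>" using \<Omega> by auto
  have n2: "2 \<le> CARD('n)" using n3 by simp
  have "gagliardo_sq s \<phi> < \<infinity>" by (rule gagliardo_sq_test_finite[OF n2 s \<phi>])
  then obtain g where g: "0 \<le> g" "gagliardo_sq s \<phi> = ennreal g"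
    by (cases "gagliardo_sq s \<phi>") auto
  have "\<forall>\<^sub>F c in at_top. S_HLM \<mu> s \<Omega> * (HL_norm \<mu> \<phi>)\<^sup>2 \<le> dirichlet_sq \<phi> + ennreal (c powr (2 * s - 2) * g)"
    using dilate_test[OF \<phi> \<Omega>(1) x0] eventually_gt_at_top[of 0]
  proof eventually_elim
    case (elim c)
    have "dilate c x0 \<phi> (x0 + inverse c *\<^sub>R z) \<noteq> 0"
      using elim z by (simp add: dilate_def)
    then have "dilate c x0 \<phi> \<noteq> (\<lambda>x. 0)" by metis
    then have "S_HLM \<mu> s \<Omega> \<le> (G_norm s (dilate c x0 \<phi>))\<^sup>2 / (HL_norm \<mu> (dilate c x0 \<phi>))\<^sup>2"
      unfolding S_HLM_def using elim by (intro INF_lower) auto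
    also have "\<dots> = (dirichlet_sq \<phi> + ennreal (c powr (2 * s - 2) * g)) / (HL_norm \<mu> \<phi>)\<^sup>2"
      unfolding G_norm_squared
      using elim g dirichlet_sq_dilate[OF \<phi> _ elim(1)] gagliardo_sq_dilate[OF test_borel[OF \<phi>], of c s x0]
        HL_norm_dilate[OF n3 test_borel[OF \<phi>], of c \<mu> x0]
      by (simp add: ennreal_mult)
    finally have "S_HLM \<mu> s \<Omega> * (HL_norm \<mu> \<phi>)\<^sup>2 \<le>
       (dirichlet_sq \<phi> + ennreal (c powr (2 * s - 2) * g)) / (HL_norm \<mu> \<phi>)\<^sup>2 * (HL_norm \<mu> \<phi>)\<^sup>2"
      by (rule mult_right_mono) simp
    then show ?case using ennreal_divide_times_le order_trans by blast
  qed
  moreover have "((\<lambda>c. dirichlet_sq \<phi> + ennreal (c powr (2 * s - 2) * g)) \<longlongrightarrow> dirichlet_sq \<phi> + ennreal (0 * g)) at_top"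
    by (intro tendsto_intros tendsto_ennrealI tendsto_neg_powr filterlim_ident) (use s in auto)
  ultimately have "S_HLM \<mu> s \<Omega> * (HL_norm \<mu> \<phi>)\<^sup>2 \<le> dirichlet_sq \<phi> + ennreal (0 * g)"
    by (intro tendsto_lowerbound) auto
  then show ?thesis by simp
qed

section \<open>Convergence in Lebesgue spaces\<close>

lemma nn_integral_limit_le:
  fixes f :: "nat \<Rightarrow> 'a \<Rightarrow> ennreal"
  assumes [measurable]: "\<And>k. f k \<in> borel_measurable M"
    and lim: "AE x in M. g x \<le> liminf (\<lambda>k. f k x)"
    and bound: "\<forall>\<^sub>F k in sequentially. (\<integral>\<^sup>+x. f k x \<partial>M) \<le> c"
  shows "(\<integral>\<^sup>+x. g x \<partial>M) \<le> c"
proof -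
  have "(\<integral>\<^sup>+x. g x \<partial>M) \<le> (\<integral>\<^sup>+x. liminf (\<lambda>k. f k x) \<partial>M)"
    by (rule nn_integral_mono_AE[OF lim])
  also have "\<dots> \<le> liminf (\<lambda>k. \<integral>\<^sup>+x. f k x \<partial>M)"
    by (rule nn_integral_liminf) simp
  also have "\<dots> \<le> c"
    by (rule Liminf_le[OF _ bound]) simp
  finally show ?thesis .
qed

text \<open>
The first few integrals may be infinite, so the subsequence is extracted from a tail.
\<close>

lemma nn_integral_tendsto_0_AE_subseq:
  fixes F :: "nat \<Rightarrow> 'a \<Rightarrow> real"
  assumes [measurable]: "\<And>k. F k \<in> borel_measurable M" and nonneg: "\<And>k x. 0 \<le> F k x"
    and lim: "(\<lambda>k. \<integral>\<^sup>+x. ennreal (F k x) \<partial>M) \<longlonglongrightarrow> 0"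
  obtains r :: "nat \<Rightarrow> nat" where "strict_mono r" "AE x in M. (\<lambda>k. F (r k) x) \<longlonglongrightarrow> 0"
proof -
  have "\<forall>\<^sub>F k in sequentially. (\<integral>\<^sup>+x. ennreal (F k x) \<partial>M) < 1"
    using order_tendstoD(2)[OF lim, of 1] by simp
  then obtain N where N: "\<And>k. N \<le> k \<Longrightarrow> (\<integral>\<^sup>+x. ennreal (F k x) \<partial>M) < 1"
    unfolding eventually_sequentially by metis
  have int: "integrable M (F (k + N))" for k
    using N[of "k + N"] nonneg by (intro integrableI_nonneg) (auto intro: less_trans)
  have "(\<lambda>k. enn2real (\<integral>\<^sup>+x. ennreal (F (k + N) x) \<partial>M)) \<longlonglongrightarrow> enn2real 0"
    using lim by (intro tendsto_enn2real LIMSEQ_ignore_initial_segment) auto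
  then have "(\<lambda>k. \<integral>x. norm (F (k + N) x) \<partial>M) \<longlonglongrightarrow> 0"
    using nonneg by (simp add: integral_eq_nn_integral)
  then obtain r :: "nat \<Rightarrow> nat" where "strict_mono r" "AE x in M. (\<lambda>k. F (r k + N) x) \<longlonglongrightarrow> 0"
    using tendsto_L1_AE_subseq[of M "\<lambda>k. F (k + N)", OF int] by auto
  then show ?thesis
    by (intro that[of "\<lambda>k. r k + N"]) (auto simp: strict_mono_def)
qed

text \<open>
Each term of the convergent series bounds \<open>\<bar>d j\<bar>\<close> by a multiple of \<open>2 powr (-j/2)\<close>.  The weights \<open>2\<^sup>j\<close> thus
turn square summability into absolute summability.
\<close>

lemma summable_of_weighted_squares:
  fixes d :: "nat \<Rightarrow> 'b::banach"
  assumes "(\<Sum>j. ennreal (2 ^ j * (norm (d j))\<^sup>2)) \<noteq> \<infinity>"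
  shows "summable d"
proof -
  define T where "T j = ennreal (2 ^ j * (norm (d j))\<^sup>2)" for j
  obtain C where C: "0 \<le> C" "suminf T = ennreal C"
    using assms unfolding T_def[symmetric] by (cases "suminf T") simp_all
  have bound: "norm (d j) \<le> sqrt C * (sqrt (1 / 2)) ^ j" for j
  proof -
    have "T j \<le> suminf T"
      using sum_le_suminf[OF summableI, of "{j}" T] by simp
    then have "2 ^ j * (norm (d j))\<^sup>2 \<le> C"
      using C unfolding T_def by (simp only: ennreal_le_iff)
    then have "(1 / 2) ^ j * (2 ^ j * (norm (d j))\<^sup>2) \<le> (1 / 2) ^ j * C"
      by (rule mult_left_mono) simp
    moreover have "(1 / 2) ^ j * (2 ^ j * (norm (d j))\<^sup>2) = (norm (d j))\<^sup>2"
      by (simp add: mult.assoc[symmetric] power_mult_distrib[symmetric])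
    ultimately have "(norm (d j))\<^sup>2 \<le> C * (1 / 2) ^ j" by (simp only: mult.commute)
    then have "norm (d j) \<le> sqrt (C * (1 / 2) ^ j)" by (rule real_le_rsqrt)
    then show ?thesis by (simp only: real_sqrt_mult real_sqrt_power)
  qed
  have "sqrt (1 / 2) < 1" by (subst real_sqrt_lt_1_iff) simp
  then have "summable (\<lambda>j. sqrt C * (sqrt (1 / 2)) ^ j)"
    by (intro summable_mult summable_geometric) simp
  then show ?thesis
    by (rule summable_comparison_test'[where N = 0]) (rule bound)
qed

text \<open>
Completeness of \<open>L\<^sup>2\<close>.  Consecutive members of a subsequence are chosen at squared distance at most
\<open>4\<^sup>-\<^sup>j\<close>.  Then the squares weighted by \<open>2\<^sup>j\<close> still have a finite total integral, so the subsequence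
telescopes to a pointwise limit almost everywhere, and Fatou's lemma turns the Cauchy property into
convergence of the whole sequence.
\<close>

lemma L2_complete:
  fixes h :: "nat \<Rightarrow> 'a \<Rightarrow> 'b::{banach, second_countable_topology}"
  assumes [measurable]: "\<And>k. h k \<in> borel_measurable M"
    and Cauchy: "\<And>e. 0 < e \<Longrightarrow> \<exists>N. \<forall>j\<ge>N. \<forall>k\<ge>N. (\<integral>\<^sup>+x. ennreal ((norm (h j x - h k x))\<^sup>2) \<partial>M) \<le> ennreal e"
  obtains g where "g \<in> borel_measurable M" "(\<lambda>k. \<integral>\<^sup>+x. ennreal ((norm (g x - h k x))\<^sup>2) \<partial>M) \<longlonglongrightarrow> 0"
proof -
  have "\<forall>j. \<exists>N. \<forall>i\<ge>N. \<forall>k\<ge>N. (\<integral>\<^sup>+x. ennreal ((norm (h i x - h k x))\<^sup>2) \<partial>M) \<le> ennreal ((1 / 4) ^ j)"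
    by (intro allI Cauchy) simp
  from choice[OF this] obtain N where "\<forall>j. \<forall>i\<ge>N j. \<forall>k\<ge>N j.
      (\<integral>\<^sup>+x. ennreal ((norm (h i x - h k x))\<^sup>2) \<partial>M) \<le> ennreal ((1 / 4) ^ j)" ..
  then have N: "(\<integral>\<^sup>+x. ennreal ((norm (h i x - h k x))\<^sup>2) \<partial>M) \<le> ennreal ((1 / 4) ^ j)"
    if "N j \<le> i" "N j \<le> k" for i j k
    using that by simp
  \<comment> \<open>Partial sums dominate every \<open>N j\<close> and tend to infinity; the summand \<open>1\<close> ensures the latter.\<close>
  define r where "r j = (\<Sum>i\<le>j. N i + 1)" for j
  have r: "N j \<le> r j" "N j \<le> r (Suc j)" "j \<le> r j" for j
  proof -
    have "N j + 1 \<le> r j"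
      unfolding r_def by (rule member_le_sum[of j "{..j}" "\<lambda>i. N i + 1"]) simp_all
    moreover have "r j \<le> r (Suc j)" unfolding r_def by simp
    ultimately show "N j \<le> r j" "N j \<le> r (Suc j)" by linarith+
    have "(\<Sum>i\<le>j. 1) \<le> r j" unfolding r_def by (intro sum_mono) simp
    then show "j \<le> r j" by simp
  qed
  define d where "d j x = h (r (Suc j)) x - h (r j) x" for j x
  have [measurable]: "d j \<in> borel_measurable M" for j unfolding d_def by measurable
  define T where "T j x = ennreal (2 ^ j * (norm (d j x))\<^sup>2)" for j x
  define W where "W x = (\<Sum>j. T j x)" for x
  have [measurable]: "T j \<in> borel_measurable M" for j unfolding T_def by measurable
  have [measurable]: "W \<in> borel_measurable M" unfolding W_def by (rule borel_measurable_suminf_order) measurable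
  have T_le: "(\<integral>\<^sup>+x. T j x \<partial>M) \<le> ennreal ((1 / 2) ^ j)" for j
  proof -
    have "(\<integral>\<^sup>+x. T j x \<partial>M) = ennreal (2 ^ j) * (\<integral>\<^sup>+x. ennreal ((norm (d j x))\<^sup>2) \<partial>M)"
      unfolding T_def by (subst nn_integral_cmult[symmetric]) (auto simp: ennreal_mult)
    also have "\<dots> \<le> ennreal (2 ^ j) * ennreal ((1 / 4) ^ j)"
      unfolding d_def by (intro mult_left_mono N r) simp
    also have "\<dots> = ennreal ((1 / 2) ^ j)"
      by (simp add: ennreal_mult[symmetric] power_mult_distrib[symmetric])
    finally show ?thesis .
  qed
  have "(\<integral>\<^sup>+x. W x \<partial>M) = (\<Sum>j. \<integral>\<^sup>+x. T j x \<partial>M)"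
    unfolding W_def by (rule nn_integral_suminf) measurable
  also have "\<dots> \<le> (\<Sum>j. ennreal ((1 / 2) ^ j))"
    by (rule suminf_le) (rule T_le summableI)+
  also have "\<dots> = ennreal (\<Sum>j. (1 / 2) ^ j)"
    by (rule suminf_ennreal2) (simp, rule summable_geometric, simp)
  finally have "(\<integral>\<^sup>+x. W x \<partial>M) < \<infinity>"
    using ennreal_less_top le_less_trans unfolding infinity_ennreal_def by blast
  then have "AE x in M. W x \<noteq> \<infinity>"
    by (intro nn_integral_noteq_infinite) simp_all
  then have AE_summable: "AE x in M. summable (\<lambda>j. d j x)"
    by (rule eventually_mono) (rule summable_of_weighted_squares, simp only: W_def T_def, blast)
  define g where "g x = lim (\<lambda>j. h (r j) x)" for x
  have [measurable]: "g \<in> borel_measurable M" unfolding g_def by measurable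
  have AE_lim: "AE x in M. (\<lambda>j. h (r j) x) \<longlonglongrightarrow> g x"
    using AE_summable
  proof (rule AE_mp, intro AE_I2 impI)
    fix x assume "summable (\<lambda>j. d j x)"
    then have "(\<lambda>n. \<Sum>j<n. d j x) \<longlonglongrightarrow> (\<Sum>j. d j x)" by (rule summable_LIMSEQ)
    moreover have "(\<Sum>j<n. d j x) = h (r n) x - h (r 0) x" for n
      using sum_lessThan_telescope[of "\<lambda>j. h (r j) x" n] by (simp add: d_def)
    ultimately have "(\<lambda>n. h (r n) x - h (r 0) x) \<longlonglongrightarrow> (\<Sum>j. d j x)" by simp
    then have "(\<lambda>n. h (r n) x - h (r 0) x + h (r 0) x) \<longlonglongrightarrow> (\<Sum>j. d j x) + h (r 0) x"
      by (intro tendsto_intros)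
    then have "convergent (\<lambda>n. h (r n) x)" by (auto simp: convergent_def)
    then show "(\<lambda>j. h (r j) x) \<longlonglongrightarrow> g x" unfolding g_def by (simp add: convergent_LIMSEQ_iff)
  qed
  have "(\<lambda>k. \<integral>\<^sup>+x. ennreal ((norm (g x - h k x))\<^sup>2) \<partial>M) \<longlonglongrightarrow> 0"
  proof (rule order_tendstoI)
    fix a :: ennreal assume "0 < a"
    then obtain e where e: "0 < e" "ennreal e < a"
    proof (cases a)
      case (real a')
      then show ?thesis using \<open>0 < a\<close> by (intro that[of "a' / 2"]) (simp_all add: ennreal_lessI)
    next
      case top
      then show ?thesis by (intro that[of 1]) simp_all
    qed
    from Cauchy[OF e(1)] obtain N where
      "\<forall>j\<ge>N. \<forall>k\<ge>N. (\<integral>\<^sup>+x. ennreal ((norm (h j x - h k x))\<^sup>2) \<partial>M) \<le> ennreal e" ..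
    then have N: "(\<integral>\<^sup>+x. ennreal ((norm (h j x - h k x))\<^sup>2) \<partial>M) \<le> ennreal e"
      if "N \<le> j" "N \<le> k" for j k
      using that by simp
    have "(\<integral>\<^sup>+x. ennreal ((norm (g x - h k x))\<^sup>2) \<partial>M) \<le> ennreal e" if k: "N \<le> k" for k
    proof (rule nn_integral_limit_le[where f = "\<lambda>j x. ennreal ((norm (h (r j) x - h k x))\<^sup>2)"])
      show "AE x in M. ennreal ((norm (g x - h k x))\<^sup>2) \<le> liminf (\<lambda>j. ennreal ((norm (h (r j) x - h k x))\<^sup>2))"
        using AE_lim
      proof (rule AE_mp, intro AE_I2 impI)
        fix x assume "(\<lambda>j. h (r j) x) \<longlonglongrightarrow> g x"
        then have "(\<lambda>j. ennreal ((norm (h (r j) x - h k x))\<^sup>2)) \<longlonglongrightarrow> ennreal ((norm (g x - h k x))\<^sup>2)"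
          by (intro tendsto_intros tendsto_ennrealI)
        then show "ennreal ((norm (g x - h k x))\<^sup>2) \<le> liminf (\<lambda>j. ennreal ((norm (h (r j) x - h k x))\<^sup>2))"
          by (intro eq_refl lim_imp_Liminf[symmetric]) simp_all
      qed
      show "\<forall>\<^sub>F j in sequentially. (\<integral>\<^sup>+x. ennreal ((norm (h (r j) x - h k x))\<^sup>2) \<partial>M) \<le> ennreal e"
        using N[OF order_trans[OF _ r(3)] k] unfolding eventually_sequentially by (intro exI[of _ N]) simp
    qed measurable
    then show "\<forall>\<^sub>F k in sequentially. (\<integral>\<^sup>+x. ennreal ((norm (g x - h k x))\<^sup>2) \<partial>M) < a"
      unfolding eventually_sequentially by (intro exI[of _ N] allI impI le_less_trans[OF _ e(2)]) simp
  qed simp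
  then show ?thesis using that[of g] by simp
qed

text \<open>
Pointwise form of the embedding of \<open>L\<^sup>q\<close> into \<open>L\<^sup>1\<close> on sets of finite measure: the first summand bounds
small values of \<open>t\<close>, the second one large values.
\<close>

lemma abs_le_eps_powr:
  fixes t :: real
  assumes "1 \<le> q" "0 < \<epsilon>"
  shows "\<bar>t\<bar> \<le> \<epsilon> + \<epsilon> powr (1 - q) * \<bar>t\<bar> powr q"
proof (cases "\<bar>t\<bar> \<le> \<epsilon>")
  case True
  then show ?thesis by (simp add: add_increasing2)
next
  case False
  then have "\<bar>t\<bar> = \<bar>t\<bar> powr (1 - q) * \<bar>t\<bar> powr q"
    using assms by (simp flip: powr_add)
  also have "\<dots> \<le> \<epsilon> powr (1 - q) * \<bar>t\<bar> powr q"
    using False assms by (intro mult_right_mono powr_mono2') auto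
  finally show ?thesis using assms by linarith
qed

lemma Lq_tendsto_L1_on:
  fixes w :: "nat \<Rightarrow> 'a \<Rightarrow> real"
  assumes [measurable]: "\<And>k. w k \<in> borel_measurable M" "K \<in> sets M" and K: "emeasure M K < \<infinity>"
    and q: "1 \<le> q" and lim: "(\<lambda>k. \<integral>\<^sup>+x. ennreal (\<bar>w k x\<bar> powr q) \<partial>M) \<longlonglongrightarrow> 0"
  shows "(\<lambda>k. \<integral>\<^sup>+x. ennreal (indicator K x * \<bar>w k x\<bar>) \<partial>M) \<longlonglongrightarrow> 0"
proof (rule order_tendstoI)
  fix a :: ennreal assume "0 < a"
  obtain m where m: "0 \<le> m" "emeasure M K = ennreal m"
    using K by (cases "emeasure M K") auto
  have "((\<lambda>\<epsilon>. ennreal (\<epsilon> * m)) \<longlongrightarrow> ennreal (0 * m)) (at_right 0)"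
    by (intro tendsto_intros tendsto_ennrealI)
  then have "\<forall>\<^sub>F \<epsilon> in at_right 0. ennreal (\<epsilon> * m) < a"
    using \<open>0 < a\<close> by (auto dest: order_tendstoD)
  then have "\<forall>\<^sub>F \<epsilon> in at_right 0. ennreal (\<epsilon> * m) < a \<and> 0 < \<epsilon>"
    by (intro eventually_conj eventually_at_right_less)
  then obtain \<epsilon> :: real where \<epsilon>: "0 < \<epsilon>" "ennreal (\<epsilon> * m) < a"
    using eventually_happens'[OF trivial_limit_at_right_real] by blast
  \<comment> \<open>\<open>\<epsilon>\<close> is spent on the part of \<open>K\<close> where \<open>\<bar>w k x\<bar> \<le> \<epsilon>\<close>, of measure at most \<open>m\<close>.\<close>
  define C where "C = \<epsilon> powr (1 - q)"
  have le: "(\<integral>\<^sup>+x. ennreal (indicator K x * \<bar>w k x\<bar>) \<partial>M) \<le>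
      ennreal (\<epsilon> * m) + ennreal C * (\<integral>\<^sup>+x. ennreal (\<bar>w k x\<bar> powr q) \<partial>M)" for k
  proof -
    have "ennreal (indicator K x * \<bar>w k x\<bar>) \<le> ennreal \<epsilon> * indicator K x + ennreal C * ennreal (\<bar>w k x\<bar> powr q)" for x
    proof (cases "x \<in> K")
      case True
      have "\<bar>w k x\<bar> \<le> \<epsilon> + C * \<bar>w k x\<bar> powr q"
        unfolding C_def by (rule abs_le_eps_powr[OF q \<epsilon>(1)])
      then have "ennreal \<bar>w k x\<bar> \<le> ennreal (\<epsilon> + C * \<bar>w k x\<bar> powr q)" by (rule ennreal_leI)
      also have "\<dots> = ennreal \<epsilon> + ennreal C * ennreal (\<bar>w k x\<bar> powr q)"
        using \<epsilon> by (simp add: C_def ennreal_mult)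
      finally show ?thesis using True by simp
    qed simp
    then have "(\<integral>\<^sup>+x. ennreal (indicator K x * \<bar>w k x\<bar>) \<partial>M) \<le>
        (\<integral>\<^sup>+x. ennreal \<epsilon> * indicator K x + ennreal C * ennreal (\<bar>w k x\<bar> powr q) \<partial>M)"
      by (rule nn_integral_mono)
    also have "\<dots> = (\<integral>\<^sup>+x. ennreal \<epsilon> * indicator K x \<partial>M) + (\<integral>\<^sup>+x. ennreal C * ennreal (\<bar>w k x\<bar> powr q) \<partial>M)"
      by (rule nn_integral_add) measurable
    also have "\<dots> = ennreal (\<epsilon> * m) + ennreal C * (\<integral>\<^sup>+x. ennreal (\<bar>w k x\<bar> powr q) \<partial>M)"
      using m \<epsilon> by (simp add: nn_integral_cmult nn_integral_cmult_indicator ennreal_mult)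
    finally show ?thesis .
  qed
  have "(\<lambda>k. ennreal (\<epsilon> * m) + ennreal C * (\<integral>\<^sup>+x. ennreal (\<bar>w k x\<bar> powr q) \<partial>M)) \<longlonglongrightarrow> ennreal (\<epsilon> * m) + ennreal C * 0"
    by (intro tendsto_add tendsto_const ennreal_tendsto_cmult lim) simp
  then have "\<forall>\<^sub>F k in sequentially. ennreal (\<epsilon> * m) + ennreal C * (\<integral>\<^sup>+x. ennreal (\<bar>w k x\<bar> powr q) \<partial>M) < a"
    using \<epsilon>(2) by (auto dest: order_tendstoD)
  then show "\<forall>\<^sub>F k in sequentially. (\<integral>\<^sup>+x. ennreal (indicator K x * \<bar>w k x\<bar>) \<partial>M) < a"
    by (rule eventually_mono) (rule le_less_trans[OF le])
qed simp

lemma Lq_locally_integrable: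
  fixes u :: "real ^ 'n::finite \<Rightarrow> 'b::{banach, second_countable_topology}"
  assumes [measurable]: "u \<in> borel_measurable borel" and q: "1 \<le> q"
    and fin: "(\<integral>\<^sup>+x. ennreal (norm (u x) powr q) \<partial>lborel) < \<infinity>"
  shows "locally_integrable u"
  unfolding locally_integrable_def set_integrable_def
proof (intro allI impI)
  fix K :: "(real ^ 'n) set" assume K: "compact K"
  then have [measurable]: "K \<in> sets borel" by (rule borel_compact)
  have i: "integrable lborel (\<lambda>x. norm (u x) powr q)"
    using fin by (intro integrableI_nonneg) auto
  have j: "integrable lborel (\<lambda>x. 1 * indicator K x :: real)"
    using K by (rule integrable_indicator_compact)
  show "integrable lborel (\<lambda>x. indicator K x *\<^sub>R u x)"
  proof (rule Bochner_Integration.integrable_bound[OF Bochner_Integration.integrable_add[OF j i]])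
    show "AE x in lborel. norm (indicator K x *\<^sub>R u x) \<le> norm (1 * indicator K x + norm (u x) powr q)"
    proof (rule AE_I2)
      fix x
      show "norm (indicator K x *\<^sub>R u x) \<le> norm (1 * indicator K x + norm (u x) powr q)"
        using abs_le_eps_powr[OF q, of 1 "norm (u x)"] by (cases "x \<in> K") simp_all
    qed
  qed measurable
qed

lemma Lq_tendsto_pairing:
  fixes w :: "nat \<Rightarrow> real ^ 'n::finite \<Rightarrow> real"
  assumes [measurable]: "\<And>k. w k \<in> borel_measurable borel"
    and q: "1 \<le> q" and lim: "(\<lambda>k. \<integral>\<^sup>+x. ennreal (\<bar>w k x\<bar> powr q) \<partial>lborel) \<longlonglongrightarrow> 0"
    and \<psi>: "\<psi> \<in> test_functions UNIV"
  shows "(\<lambda>k. LINT x|lborel. w k x * \<psi> x) \<longlonglongrightarrow> 0"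
proof -
  obtain B K where K: "compact K" "0 \<le> B" and B: "\<And>x. \<bar>\<psi> x\<bar> \<le> B * indicator K x"
    by (rule test_bounded[OF \<psi>]) (rule that)
  have [measurable]: "K \<in> sets borel" using K(1) by (rule borel_compact)
  have [measurable]: "\<psi> \<in> borel_measurable borel" by (rule test_borel[OF \<psi>])
  have L1: "(\<lambda>k. \<integral>\<^sup>+x. ennreal (indicator K x * \<bar>w k x\<bar>) \<partial>lborel) \<longlonglongrightarrow> 0"
    using emeasure_compact_finite[OF K(1)] by (intro Lq_tendsto_L1_on[OF _ _ _ q lim]) simp_all
  have upper: "(\<integral>\<^sup>+x. ennreal \<bar>w k x * \<psi> x\<bar> \<partial>lborel) \<le> ennreal B * (\<integral>\<^sup>+x. ennreal (indicator K x * \<bar>w k x\<bar>) \<partial>lborel)" for k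
  proof -
    have "\<bar>w k x * \<psi> x\<bar> \<le> B * (indicator K x * \<bar>w k x\<bar>)" for x
      using mult_left_mono[OF B[of x], of "\<bar>w k x\<bar>"] by (simp add: abs_mult mult_ac)
    then have "(\<integral>\<^sup>+x. ennreal \<bar>w k x * \<psi> x\<bar> \<partial>lborel) \<le> (\<integral>\<^sup>+x. ennreal (B * (indicator K x * \<bar>w k x\<bar>)) \<partial>lborel)"
      by (intro nn_integral_mono ennreal_leI)
    also have "\<dots> = (\<integral>\<^sup>+x. ennreal B * ennreal (indicator K x * \<bar>w k x\<bar>) \<partial>lborel)"
      using K(2) by (simp add: ennreal_mult)
    also have "\<dots> = ennreal B * (\<integral>\<^sup>+x. ennreal (indicator K x * \<bar>w k x\<bar>) \<partial>lborel)"
      by (rule nn_integral_cmult) measurable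
    finally show ?thesis .
  qed
  have "(\<lambda>k. ennreal B * (\<integral>\<^sup>+x. ennreal (indicator K x * \<bar>w k x\<bar>) \<partial>lborel)) \<longlonglongrightarrow> ennreal B * 0"
    by (intro ennreal_tendsto_cmult L1) simp
  then have lim0: "(\<lambda>k. ennreal B * (\<integral>\<^sup>+x. ennreal (indicator K x * \<bar>w k x\<bar>) \<partial>lborel)) \<longlonglongrightarrow> 0"
    by (simp only: mult_zero_right)
  have "(\<lambda>k. \<integral>\<^sup>+x. ennreal \<bar>w k x * \<psi> x\<bar> \<partial>lborel) \<longlonglongrightarrow> 0"
    by (rule tendsto_sandwich[OF _ _ tendsto_const lim0]) (intro always_eventually allI zero_le upper)+
  then have "(\<lambda>k. enn2real (\<integral>\<^sup>+x. ennreal \<bar>w k x * \<psi> x\<bar> \<partial>lborel)) \<longlonglongrightarrow> enn2real 0"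
    by (intro tendsto_enn2real) simp_all
  then have lim1: "(\<lambda>k. enn2real (\<integral>\<^sup>+x. ennreal \<bar>w k x * \<psi> x\<bar> \<partial>lborel)) \<longlonglongrightarrow> 0"
    by (simp only: enn2real_0)
  have "norm (LINT x|lborel. w k x * \<psi> x) \<le> enn2real (\<integral>\<^sup>+x. ennreal \<bar>w k x * \<psi> x\<bar> \<partial>lborel)" for k
  proof -
    have "norm (LINT x|lborel. w k x * \<psi> x) \<le> (LINT x|lborel. norm (w k x * \<psi> x))"
      by (rule integral_norm_bound)
    also have "\<dots> = enn2real (\<integral>\<^sup>+x. ennreal \<bar>w k x * \<psi> x\<bar> \<partial>lborel)"
      by (subst integral_eq_nn_integral) simp_all
    finally show ?thesis .
  qed
  then show ?thesis
    by (intro Lim_null_comparison[OF _ lim1] always_eventually allI)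
qed

section \<open>Limits of test functions\<close>

lemma norm_squared_young:
  fixes x y :: "'a::real_normed_vector"
  assumes \<delta>: "0 < \<delta>"
  shows "(norm x)\<^sup>2 \<le> (1 + \<delta>) * (norm y)\<^sup>2 + (1 + 1 / \<delta>) * (norm (y - x))\<^sup>2"
proof -
  define a b where "a = norm (y - x)" and "b = norm y"
  have "norm x \<le> b + a"
    unfolding a_def b_def using norm_triangle_ineq4[of y "y - x"] by simp
  then have "(norm x)\<^sup>2 \<le> (b + a)\<^sup>2" by (intro power_mono) simp_all
  also have "\<dots> \<le> (1 + \<delta>) * b\<^sup>2 + (1 + 1 / \<delta>) * a\<^sup>2"
  proof -
    have "0 \<le> (\<delta> * b - a)\<^sup>2 / \<delta>" using \<delta> by simp
    also have "\<dots> = \<delta> * b\<^sup>2 - 2 * a * b + a\<^sup>2 / \<delta>"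
      using \<delta> by (simp add: power2_eq_square field_simps)
    finally show ?thesis by (simp add: power2_eq_square algebra_simps)
  qed
  finally show ?thesis by (simp add: a_def b_def)
qed

lemma nn_integral_norm_squared_young:
  fixes f g :: "'a \<Rightarrow> 'b::{second_countable_topology, real_normed_vector}"
  assumes [measurable]: "f \<in> borel_measurable M" "g \<in> borel_measurable M" and \<delta>: "0 < \<delta>"
  shows "(\<integral>\<^sup>+x. ennreal ((norm (f x))\<^sup>2) \<partial>M) \<le> ennreal (1 + \<delta>) * (\<integral>\<^sup>+x. ennreal ((norm (g x))\<^sup>2) \<partial>M) +
     ennreal (1 + 1 / \<delta>) * (\<integral>\<^sup>+x. ennreal ((norm (g x - f x))\<^sup>2) \<partial>M)"
proof -
  have "(\<integral>\<^sup>+x. ennreal ((norm (f x))\<^sup>2) \<partial>M) \<le>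
     (\<integral>\<^sup>+x. ennreal (1 + \<delta>) * ennreal ((norm (g x))\<^sup>2) + ennreal (1 + 1 / \<delta>) * ennreal ((norm (g x - f x))\<^sup>2) \<partial>M)"
  proof (rule nn_integral_mono)
    fix x
    have "ennreal ((norm (f x))\<^sup>2) \<le> ennreal ((1 + \<delta>) * (norm (g x))\<^sup>2 + (1 + 1 / \<delta>) * (norm (g x - f x))\<^sup>2)"
      by (intro ennreal_leI norm_squared_young \<delta>)
    also have "\<dots> = ennreal ((1 + \<delta>) * (norm (g x))\<^sup>2) + ennreal ((1 + 1 / \<delta>) * (norm (g x - f x))\<^sup>2)"
      using \<delta> by (intro ennreal_plus) simp_all
    also have "\<dots> = ennreal (1 + \<delta>) * ennreal ((norm (g x))\<^sup>2) + ennreal (1 + 1 / \<delta>) * ennreal ((norm (g x - f x))\<^sup>2)"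
      using \<delta> by (intro arg_cong2[where f = "(+)"] ennreal_mult) simp_all
    finally show "ennreal ((norm (f x))\<^sup>2) \<le> \<dots>" .
  qed
  also have "\<dots> = (\<integral>\<^sup>+x. ennreal (1 + \<delta>) * ennreal ((norm (g x))\<^sup>2) \<partial>M) +
      (\<integral>\<^sup>+x. ennreal (1 + 1 / \<delta>) * ennreal ((norm (g x - f x))\<^sup>2) \<partial>M)"
    by (rule nn_integral_add) measurable
  also have "\<dots> = ennreal (1 + \<delta>) * (\<integral>\<^sup>+x. ennreal ((norm (g x))\<^sup>2) \<partial>M) +
     ennreal (1 + 1 / \<delta>) * (\<integral>\<^sup>+x. ennreal ((norm (g x - f x))\<^sup>2) \<partial>M)"
    by (intro arg_cong2[where f = "(+)"] nn_integral_cmult) measurable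
  finally show ?thesis .
qed

text \<open>
Upper semicontinuity of the \<open>L\<^sup>2\<close> norm along a convergent sequence.  Young's inequality gives the
bound \<open>(1 + \<delta>) \<parallel>g\<parallel>\<^sup>2 + (1 + 1/\<delta>) \<parallel>g - h k\<parallel>\<^sup>2\<close>; first \<open>\<delta>\<close> is fixed small, then \<open>k\<close> is sent to infinity.
\<close>

lemma L2_limit_eventually_less:
  fixes g :: "'a \<Rightarrow> 'b::{second_countable_topology, real_normed_vector}"
  assumes [measurable]: "\<And>k. h k \<in> borel_measurable M" "g \<in> borel_measurable M"
    and lim: "(\<lambda>k. \<integral>\<^sup>+x. ennreal ((norm (g x - h k x))\<^sup>2) \<partial>M) \<longlonglongrightarrow> 0"
    and less: "(\<integral>\<^sup>+x. ennreal ((norm (g x))\<^sup>2) \<partial>M) < c"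
  shows "\<forall>\<^sub>F k in sequentially. (\<integral>\<^sup>+x. ennreal ((norm (h k x))\<^sup>2) \<partial>M) < c"
proof -
  define G where "G = (\<integral>\<^sup>+x. ennreal ((norm (g x))\<^sup>2) \<partial>M)"
  define \<eta> where "\<eta> k = (\<integral>\<^sup>+x. ennreal ((norm (g x - h k x))\<^sup>2) \<partial>M)" for k
  have "G < top" unfolding G_def by (rule order.strict_trans2[OF less top_greatest])
  then obtain G' where G': "0 \<le> G'" "G = ennreal G'" by (cases G) simp_all
  have "((\<lambda>\<delta>. ennreal ((1 + \<delta>) * G')) \<longlongrightarrow> ennreal ((1 + 0) * G')) (at_right 0)"
    by (intro tendsto_intros tendsto_ennrealI)
  then have "\<forall>\<^sub>F \<delta> in at_right 0. ennreal ((1 + \<delta>) * G') < c"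
    by (rule order_tendstoD(2)) (use less G' in \<open>simp add: G_def[symmetric]\<close>)
  then have "\<forall>\<^sub>F \<delta> in at_right 0. ennreal ((1 + \<delta>) * G') < c \<and> 0 < \<delta>"
    by (intro eventually_conj eventually_at_right_less)
  then obtain \<delta> :: real where \<delta>: "0 < \<delta>" "ennreal ((1 + \<delta>) * G') < c"
    using eventually_happens'[OF trivial_limit_at_right_real] by blast
  have "(\<lambda>k. ennreal (1 + \<delta>) * G + ennreal (1 + 1 / \<delta>) * \<eta> k) \<longlonglongrightarrow> ennreal (1 + \<delta>) * G + ennreal (1 + 1 / \<delta>) * 0"
    by (intro tendsto_add tendsto_const ennreal_tendsto_cmult lim[folded \<eta>_def]) simp
  then have "\<forall>\<^sub>F k in sequentially. ennreal (1 + \<delta>) * G + ennreal (1 + 1 / \<delta>) * \<eta> k < c"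
  proof (rule order_tendstoD(2))
    have "ennreal (1 + \<delta>) * G = ennreal ((1 + \<delta>) * G')"
      unfolding G'(2) using G'(1) \<delta>(1) by (intro ennreal_mult[symmetric]) simp_all
    then show "ennreal (1 + \<delta>) * G + ennreal (1 + 1 / \<delta>) * 0 < c"
      using \<delta>(2) by (simp only: mult_zero_right add_0_right)
  qed
  then show ?thesis
  proof (rule eventually_mono)
    fix k
    assume less: "ennreal (1 + \<delta>) * G + ennreal (1 + 1 / \<delta>) * \<eta> k < c"
    have "(\<integral>\<^sup>+x. ennreal ((norm (h k x))\<^sup>2) \<partial>M) \<le> ennreal (1 + \<delta>) * G + ennreal (1 + 1 / \<delta>) * \<eta> k"
      unfolding G_def \<eta>_def by (intro nn_integral_norm_squared_young assms \<delta>)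
    then show "(\<integral>\<^sup>+x. ennreal ((norm (h k x))\<^sup>2) \<partial>M) < c"
      using less by (rule le_less_trans)
  qed
qed

lemma dirichlet_sq_test_finite:
  fixes \<phi> :: "real ^ 'n::finite \<Rightarrow> real"
  assumes \<phi>: "\<phi> \<in> test_functions \<Omega>"
  shows "(\<integral>\<^sup>+x. ennreal ((norm (grad \<phi> x))\<^sup>2) \<partial>lborel) < \<infinity>"
proof -
  have eq: "(norm (grad \<phi> x))\<^sup>2 = (\<Sum>i\<in>UNIV. partial_deriv i \<phi> x * partial_deriv i \<phi> x)" for x
    by (simp add: power2_norm_eq_inner inner_vec_def grad_def)
  have "integrable lborel (\<lambda>x. (norm (grad \<phi> x))\<^sup>2)"
    unfolding eq using test_integrable[OF test_mult[OF test_partial_deriv[OF \<phi>] test_partial_deriv[OF \<phi>]]]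
    by (intro Bochner_Integration.integrable_sum)
  then have "(\<integral>\<^sup>+x. ennreal (norm ((norm (grad \<phi> x))\<^sup>2)) \<partial>lborel) < \<infinity>"
    unfolding integrable_iff_bounded by blast
  then show ?thesis by simp
qed

lemma grad_borel:
  assumes "\<phi> \<in> test_functions \<Omega>" shows "grad \<phi> \<in> borel_measurable borel"
  by (intro borel_measurable_continuous_onI continuous_grad test_smooth[OF assms])

lemma grad_diff:
  assumes "\<phi> \<in> test_functions \<Omega>" "\<psi> \<in> test_functions \<Omega>"
  shows "grad (\<lambda>x. \<phi> x - \<psi> x) x = grad \<phi> x - grad \<psi> x"
  by (simp add: grad_def vec_eq_iff partial_deriv_diff[OF assms])

lemma powr_2_eq_squared: "0 \<le> t \<Longrightarrow> t powr 2 = (t::real)\<^sup>2"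
  by (cases "t = 0") simp_all

text \<open>
The weak gradient is a closed operator.  The gradients form a Cauchy sequence in \<open>L\<^sup>2\<close>, and
their limit \<open>g\<close> inherits the integration by parts identity, because both sides of it are continuous under
\<open>L\<^sup>q\<close> and \<open>L\<^sup>2\<close> convergence when paired with a fixed test function.
\<close>

lemma weak_gradient_of_limit:
  fixes u :: "real ^ 'n::finite \<Rightarrow> real"
  assumes u [measurable]: "u \<in> borel_measurable borel" and q: "1 \<le> q"
    and u_Lq: "(\<integral>\<^sup>+x. ennreal (\<bar>u x\<bar> powr q) \<partial>lborel) < \<infinity>"
    and \<phi>: "\<And>k. \<phi> k \<in> test_functions \<Omega>"
    and Cauchy: "\<And>e. 0 < e \<Longrightarrow> \<exists>N. \<forall>j\<ge>N. \<forall>k\<ge>N. dirichlet_sq (\<lambda>x. \<phi> j x - \<phi> k x) \<le> ennreal e"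
    and lim: "(\<lambda>k. \<integral>\<^sup>+x. ennreal (\<bar>\<phi> k x - u x\<bar> powr q) \<partial>lborel) \<longlonglongrightarrow> 0"
  obtains g where "g \<in> borel_measurable borel" "is_weak_gradient u g"
    "(\<integral>\<^sup>+x. ennreal ((norm (g x))\<^sup>2) \<partial>lborel) < \<infinity>"
    "(\<lambda>k. \<integral>\<^sup>+x. ennreal ((norm (g x - grad (\<phi> k) x))\<^sup>2) \<partial>lborel) \<longlonglongrightarrow> 0"
proof -
  have [measurable]: "\<phi> k \<in> borel_measurable borel" "grad (\<phi> k) \<in> borel_measurable borel" for k
    using \<phi> test_borel grad_borel by blast+
  have "dirichlet_sq (\<lambda>x. \<phi> j x - \<phi> k x) = (\<integral>\<^sup>+x. ennreal ((norm (grad (\<phi> j) x - grad (\<phi> k) x))\<^sup>2) \<partial>lborel)" for j k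
    unfolding dirichlet_sq_test[OF test_diff[OF \<phi> \<phi>]] grad_diff[OF \<phi> \<phi>] ..
  with Cauchy have Cauchy': "\<exists>N. \<forall>j\<ge>N. \<forall>k\<ge>N. (\<integral>\<^sup>+x. ennreal ((norm (grad (\<phi> j) x - grad (\<phi> k) x))\<^sup>2) \<partial>lborel) \<le> ennreal e"
    if "0 < e" for e using that by simp
  obtain g where g: "g \<in> borel_measurable lborel"
    "(\<lambda>k. \<integral>\<^sup>+x. ennreal ((norm (g x - grad (\<phi> k) x))\<^sup>2) \<partial>lborel) \<longlonglongrightarrow> 0"
    by (rule L2_complete[of "\<lambda>k. grad (\<phi> k)" lborel, OF _ Cauchy']) (simp, assumption, rule that)
  have [measurable]: "g \<in> borel_measurable borel" using g(1) by simp
  \<comment> \<open>\<open>g\<close> is square integrable, being at finite distance from one of the gradients.\<close>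
  have "\<forall>\<^sub>F k in sequentially. (\<integral>\<^sup>+x. ennreal ((norm (g x - grad (\<phi> k) x))\<^sup>2) \<partial>lborel) < 1"
    using order_tendstoD(2)[OF g(2), of 1] by simp
  then obtain k where k: "(\<integral>\<^sup>+x. ennreal ((norm (g x - grad (\<phi> k) x))\<^sup>2) \<partial>lborel) < 1"
    using eventually_happens'[OF trivial_limit_sequentially] by blast
  have "(\<integral>\<^sup>+x. ennreal ((norm (g x))\<^sup>2) \<partial>lborel) \<le> ennreal (1 + 1) * (\<integral>\<^sup>+x. ennreal ((norm (grad (\<phi> k) x))\<^sup>2) \<partial>lborel) +
     ennreal (1 + 1 / 1) * (\<integral>\<^sup>+x. ennreal ((norm (grad (\<phi> k) x - g x))\<^sup>2) \<partial>lborel)"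
    by (rule nn_integral_norm_squared_young) simp_all
  also have "\<dots> < \<infinity>"
    using dirichlet_sq_test_finite[OF \<phi>[of k]] k less_trans[OF k ennreal_one_less_top]
    by (simp add: norm_minus_commute ennreal_mult_less_top)
  finally have g_L2: "(\<integral>\<^sup>+x. ennreal ((norm (g x))\<^sup>2) \<partial>lborel) < \<infinity>" .
  have loc: "locally_integrable u" "locally_integrable g"
    using Lq_locally_integrable[OF u q] u_Lq Lq_locally_integrable[of g 2] g_L2
    by (simp_all add: powr_2_eq_squared)
  have lim_g: "(\<lambda>k. \<integral>\<^sup>+x. ennreal (\<bar>grad (\<phi> k) x $ i - g x $ i\<bar> powr 2) \<partial>lborel) \<longlonglongrightarrow> 0" for i
  proof (rule tendsto_sandwich[OF _ _ tendsto_const g(2)]; intro always_eventually allI)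
    fix k
    show "(\<integral>\<^sup>+x. ennreal (\<bar>grad (\<phi> k) x $ i - g x $ i\<bar> powr 2) \<partial>lborel) \<le>
        (\<integral>\<^sup>+x. ennreal ((norm (g x - grad (\<phi> k) x))\<^sup>2) \<partial>lborel)"
    proof (intro nn_integral_mono ennreal_leI)
      fix x
      have "\<bar>grad (\<phi> k) x $ i - g x $ i\<bar> \<le> norm (g x - grad (\<phi> k) x)"
        using component_le_norm_cart[of "grad (\<phi> k) x - g x" i] by (simp add: norm_minus_commute)
      then show "\<bar>grad (\<phi> k) x $ i - g x $ i\<bar> powr 2 \<le> (norm (g x - grad (\<phi> k) x))\<^sup>2"
        unfolding powr_2_eq_squared[OF abs_ge_zero] by (intro power_mono) simp_all
    qed
  qed simp
  have "(LINT x|lborel. u x * partial_deriv i \<psi> x) = - (LINT x|lborel. g x $ i * \<psi> x)"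
    if \<psi>: "\<psi> \<in> test_functions UNIV" for \<psi> i
  proof -
    have d\<psi>: "partial_deriv i \<psi> \<in> test_functions UNIV" by (rule test_partial_deriv[OF \<psi>])
    have loc_g: "locally_integrable (\<lambda>x. g x $ i)"
      using loc(2) by (rule locally_integrable_component)
    have \<phi>': "\<phi> k \<in> test_functions UNIV" for k using \<phi> by (rule test_functions_mono)
    have weak: "(LINT x|lborel. \<phi> k x * partial_deriv i \<psi> x) = - (LINT x|lborel. grad (\<phi> k) x $ i * \<psi> x)" for k
      using grad_is_weak_gradient[OF \<phi>[of k]] \<psi> unfolding is_weak_gradient_def by simp
    have "(\<lambda>k. LINT x|lborel. (\<phi> k x - u x) * partial_deriv i \<psi> x) \<longlonglongrightarrow> 0"
      by (rule Lq_tendsto_pairing[OF _ q lim d\<psi>]) measurable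
    moreover have "(LINT x|lborel. (\<phi> k x - u x) * partial_deriv i \<psi> x) =
        (LINT x|lborel. \<phi> k x * partial_deriv i \<psi> x) - (LINT x|lborel. u x * partial_deriv i \<psi> x)" for k
      unfolding left_diff_distrib
      by (intro Bochner_Integration.integral_diff test_integrable[OF test_mult[OF \<phi>' d\<psi>]]
          locally_integrable_times_test[OF loc(1) d\<psi>])
    ultimately have 1: "(\<lambda>k. LINT x|lborel. \<phi> k x * partial_deriv i \<psi> x) \<longlonglongrightarrow> (LINT x|lborel. u x * partial_deriv i \<psi> x)"
      by (simp add: LIM_zero_iff)
    have "(\<lambda>k. LINT x|lborel. (grad (\<phi> k) x $ i - g x $ i) * \<psi> x) \<longlonglongrightarrow> 0"
    proof (rule Lq_tendsto_pairing[OF _ _ lim_g \<psi>])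
      have nth: "(\<lambda>x. v x $ i) \<in> borel_measurable borel" if "v \<in> borel_measurable borel"
        for v :: "real ^ 'n \<Rightarrow> real ^ 'n"
        using that by (rule measurable_compose) (intro borel_measurable_continuous_onI linear_continuous_on bounded_linear_vec_nth)
      show "(\<lambda>x. grad (\<phi> k) x $ i - g x $ i) \<in> borel_measurable borel" for k
        by (intro borel_measurable_diff nth) measurable
    qed simp
    moreover have "(LINT x|lborel. (grad (\<phi> k) x $ i - g x $ i) * \<psi> x) =
        (LINT x|lborel. grad (\<phi> k) x $ i * \<psi> x) - (LINT x|lborel. g x $ i * \<psi> x)" for k
      unfolding left_diff_distrib
    proof (rule Bochner_Integration.integral_diff)
      show "integrable lborel (\<lambda>x. grad (\<phi> k) x $ i * \<psi> x)"
        using test_integrable[OF test_mult[OF test_partial_deriv[OF \<phi>'[of k], of i] \<psi>]] by (simp add: grad_def)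
      show "integrable lborel (\<lambda>x. g x $ i * \<psi> x)"
        by (rule locally_integrable_times_test[OF loc_g \<psi>])
    qed
    ultimately have "(\<lambda>k. LINT x|lborel. grad (\<phi> k) x $ i * \<psi> x) \<longlonglongrightarrow> (LINT x|lborel. g x $ i * \<psi> x)"
      by (simp add: LIM_zero_iff)
    then have "(\<lambda>k. LINT x|lborel. \<phi> k x * partial_deriv i \<psi> x) \<longlonglongrightarrow> - (LINT x|lborel. g x $ i * \<psi> x)"
      unfolding weak by (rule tendsto_minus)
    then show ?thesis by (rule LIMSEQ_unique[OF 1])
  qed
  then have "is_weak_gradient u g"
    unfolding is_weak_gradient_def using loc by simp
  then show ?thesis using that[of g] g g_L2 by simp
qed

text \<open>
The map \<open>x \<mapsto> S (epowr x a)\<^sup>2\<close> has closed sublevel sets, including the degenerate cases in which \<open>S\<close> or \<open>c\<close>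
is \<open>0\<close> or \<open>\<infinity>\<close>.  Thus a bound on the Hardy--Littlewood norm is a bound on the double integral, to
which Fatou's lemma applies.
\<close>

lemma epowr_sublevel:
  assumes a: "0 < a"
  obtains t where "\<And>x. S * (epowr x a)\<^sup>2 \<le> c \<longleftrightarrow> x \<le> t"
proof -
  have epowr_0: "(epowr x a)\<^sup>2 = 0 \<longleftrightarrow> x = 0" for x
    using a by (cases x) (auto simp: epowr_def)
  consider "S = 0 \<or> c = \<infinity>" | "S = \<infinity>" "c \<noteq> \<infinity>" | S' c' where "0 < S'" "S = ennreal S'" "0 \<le> c'" "c = ennreal c'"
    by (cases S; cases c) (auto simp: le_less)
  then show ?thesis
  proof cases
    case 1
    then show ?thesis by (intro that[of \<infinity>]) auto
  next
    case 2
    have "S * (epowr x a)\<^sup>2 \<le> c \<longleftrightarrow> x \<le> 0" for x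
      using 2 epowr_0[of x] by (cases "x = 0") (simp_all add: ennreal_top_mult top_unique)
    then show ?thesis by (rule that)
  next
    case 3
    define t where "t = sqrt (c' / S') powr (1 / a)"
    have "S * (epowr x a)\<^sup>2 \<le> c \<longleftrightarrow> x \<le> ennreal t" for x
    proof (cases x)
      case (real r)
      have "S * (epowr x a)\<^sup>2 \<le> c \<longleftrightarrow> S' * (r powr a)\<^sup>2 \<le> c'"
        using 3 real by (simp add: epowr_def ennreal_power ennreal_mult[symmetric])
      also have "\<dots> \<longleftrightarrow> (r powr a)\<^sup>2 \<le> c' / S'" using 3 by (simp add: field_simps)
      also have "\<dots> \<longleftrightarrow> r powr a \<le> sqrt (c' / S')"
      proof
        assume "(r powr a)\<^sup>2 \<le> c' / S'"
        then show "r powr a \<le> sqrt (c' / S')" by (rule real_le_rsqrt)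
      next
        assume "r powr a \<le> sqrt (c' / S')"
        then have "(r powr a)\<^sup>2 \<le> (sqrt (c' / S'))\<^sup>2" by (rule power_mono) simp
        then show "(r powr a)\<^sup>2 \<le> c' / S'" using 3 by simp
      qed
      also have "\<dots> \<longleftrightarrow> r powr a \<le> t powr a"
        using a 3 by (simp add: t_def powr_powr)
      also have "\<dots> \<longleftrightarrow> r \<le> t"
      proof
        assume le: "r powr a \<le> t powr a"
        have "0 \<le> t" by (simp add: t_def)
        then show "r \<le> t" using powr_less_mono2[OF a, of t r] le by linarith
      next
        assume "r \<le> t"
        then show "r powr a \<le> t powr a" using a real by (intro powr_mono2) simp_all
      qed
      finally show ?thesis using real by (simp add: t_def)
    next
      case top
      then show ?thesis using 3 by (simp add: epowr_def ennreal_mult_top top_unique power2_eq_square)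
    qed
    then show ?thesis by (rule that)
  qed
qed

text \<open>
Fatou's lemma, applied once in each variable.
\<close>

lemma HL_norm_lower_semicontinuous:
  fixes u :: "real ^ 'n::finite \<Rightarrow> real"
  assumes [measurable]: "\<And>k. w k \<in> borel_measurable borel" and p: "0 < HL_exponent TYPE('n) \<mu>"
    and lim: "AE x in lborel. (\<lambda>k. w k x) \<longlonglongrightarrow> u x"
    and bound: "\<forall>\<^sub>F k in sequentially. S * (HL_norm \<mu> (w k))\<^sup>2 \<le> c"
  shows "S * (HL_norm \<mu> u)\<^sup>2 \<le> c"
proof -
  define p where "p = HL_exponent TYPE('n) \<mu>"
  have p0: "0 < p" using p by (simp add: p_def)
  define K where "K v x y = ennreal (\<bar>v x\<bar> powr p * \<bar>v y\<bar> powr p / norm (x - y) powr \<mu>)" for v and x y :: "real ^ 'n"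
  have HL: "HL_norm \<mu> v = epowr (\<integral>\<^sup>+x. \<integral>\<^sup>+y. K v x y \<partial>lborel \<partial>lborel) (1 / (2 * p))" for v
    unfolding HL_norm_def K_def p_def Let_def ..
  obtain t where t: "\<And>x. S * (epowr x (1 / (2 * p)))\<^sup>2 \<le> c \<longleftrightarrow> x \<le> t"
    by (rule epowr_sublevel[of "1 / (2 * p)" S c]) (use p0 in simp, rule that)
  have [measurable]: "(\<lambda>(x, y). K (w k) x y) \<in> borel_measurable (borel \<Otimes>\<^sub>M borel)" for k
    unfolding K_def by measurable
  have "(\<integral>\<^sup>+x. \<integral>\<^sup>+y. K u x y \<partial>lborel \<partial>lborel) \<le> t"
  proof (rule nn_integral_limit_le[where f = "\<lambda>k x. \<integral>\<^sup>+y. K (w k) x y \<partial>lborel"])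
    show "\<forall>\<^sub>F k in sequentially. (\<integral>\<^sup>+x. \<integral>\<^sup>+y. K (w k) x y \<partial>lborel \<partial>lborel) \<le> t"
      using bound unfolding HL t .
    show "AE x in lborel. (\<integral>\<^sup>+y. K u x y \<partial>lborel) \<le> liminf (\<lambda>k. \<integral>\<^sup>+y. K (w k) x y \<partial>lborel)"
      using lim
    proof (rule AE_mp, intro AE_I2 impI)
      fix x assume x: "(\<lambda>k. w k x) \<longlonglongrightarrow> u x"
      have "AE y in lborel. K u x y = liminf (\<lambda>k. K (w k) x y)"
        using lim
      proof (rule AE_mp, intro AE_I2 impI)
        fix y assume y: "(\<lambda>k. w k y) \<longlonglongrightarrow> u y"
        have powr: "(\<lambda>k. \<bar>w k z\<bar> powr p) \<longlonglongrightarrow> \<bar>u z\<bar> powr p" if "(\<lambda>k. w k z) \<longlonglongrightarrow> u z" for z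
          using p0 by (intro tendsto_powr' tendsto_rabs that tendsto_const) simp
        have "(\<lambda>k. K (w k) x y) \<longlonglongrightarrow> K u x y"
          unfolding K_def divide_inverse
          by (intro tendsto_ennrealI tendsto_mult powr x y tendsto_const)
        then show "K u x y = liminf (\<lambda>k. K (w k) x y)"
          by (intro lim_imp_Liminf[symmetric]) simp_all
      qed
      then have "(\<integral>\<^sup>+y. K u x y \<partial>lborel) = (\<integral>\<^sup>+y. liminf (\<lambda>k. K (w k) x y) \<partial>lborel)"
        by (rule nn_integral_cong_AE)
      also have "\<dots> \<le> liminf (\<lambda>k. \<integral>\<^sup>+y. K (w k) x y \<partial>lborel)"
        by (rule nn_integral_liminf) measurable
      finally show "(\<integral>\<^sup>+y. K u x y \<partial>lborel) \<le> liminf (\<lambda>k. \<integral>\<^sup>+y. K (w k) x y \<partial>lborel)" .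
    qed
  qed measurable
  then show ?thesis unfolding HL t .
qed

text \<open>
If the double integral vanishes, then for almost every \<open>x\<close> the function agrees with \<open>u x\<close> almost everywhere;
one such \<open>x\<close> is enough.
\<close>

lemma gagliardo_sq_eq_0_imp_constant:
  fixes u :: "real ^ 'n::finite \<Rightarrow> real"
  assumes n: "2 \<le> CARD('n)" and s: "0 < s" "s < 1" and [measurable]: "u \<in> borel_measurable borel"
    and zero: "gagliardo_sq s u = 0"
  obtains b where "AE x in lborel. u x = b"
proof -
  define K where "K x y = ennreal (\<bar>u x - u y\<bar>\<^sup>2 / norm (x - y) powr (real CARD('n) + 2 * s))" for x y
  have [measurable]: "(\<lambda>(x, y). K x y) \<in> borel_measurable (borel \<Otimes>\<^sub>M borel)"
    unfolding K_def by measurable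
  have "frac_const TYPE('n) s / 2 \<noteq> 0"
    using frac_const_nondegenerate(1)[OF n s] by (simp add: ennreal_divide_eq_0_iff)
  then have "(\<integral>\<^sup>+x. \<integral>\<^sup>+y. K x y \<partial>lborel \<partial>lborel) = 0"
    using zero unfolding gagliardo_sq_def K_def by simp
  then have "AE x in lborel. (\<integral>\<^sup>+y. K x y \<partial>lborel) = 0"
    by (subst (asm) nn_integral_0_iff_AE) simp_all
  then obtain x where "(\<integral>\<^sup>+y. K x y \<partial>lborel) = 0"
    using eventually_happens'[of "ae_filter lborel"] by (auto simp: ae_filter_eq_bot_iff)
  then have "AE y in lborel. K x y = 0"
    by (subst (asm) nn_integral_0_iff_AE) simp_all
  then have "AE y in lborel. u y = u x"
  proof (rule AE_mp, intro AE_I2 impI)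
    fix y assume "K x y = 0"
    then have "\<bar>u x - u y\<bar>\<^sup>2 / norm (x - y) powr (real CARD('n) + 2 * s) \<le> 0"
      unfolding K_def by (simp only: ennreal_eq_0_iff)
    then show "u y = u x" by (cases "x = y") (auto simp: divide_le_0_iff)
  qed
  then show ?thesis by (rule that)
qed

lemma constant_Lq_eq_0:
  fixes u :: "'a::euclidean_space \<Rightarrow> real"
  assumes const: "AE x in lborel. u x = b" and fin: "(\<integral>\<^sup>+x. ennreal (\<bar>u x\<bar> powr q) \<partial>lborel) < \<infinity>"
  shows "b = 0"
proof (rule ccontr)
  assume b: "b \<noteq> 0"
  have "(\<integral>\<^sup>+x. ennreal (\<bar>u x\<bar> powr q) \<partial>lborel) = (\<integral>\<^sup>+x. ennreal (\<bar>b\<bar> powr q) \<partial>(lborel :: 'a measure))"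
    using const by (intro nn_integral_cong_AE) auto
  also have "\<dots> = \<infinity>" using b by (simp add: ennreal_mult_top)
  finally show False using fin by simp
qed

section \<open>No extremal functions\<close>

theorem theorem1p3:
  fixes \<mu> s :: real and \<Omega> :: "(real ^ 'n::finite) set"
  assumes "CARD('n) \<ge> 3"
    and "0 < \<mu>" and "\<mu> < real CARD('n)"
    and "0 < s" and "s < 1"
    and "open \<Omega>" and "\<Omega> \<noteq> {}"
  shows "\<not> (\<exists>u\<in>Pi_space s \<Omega>. \<not> (AE x in lborel. u x = 0) \<and>
           (G_norm s u)\<^sup>2 = S_HLM \<mu> s \<Omega> * (HL_norm \<mu> u)\<^sup>2)"
proof (rule notI, elim bexE conjE)
  fix u :: "real ^ 'n \<Rightarrow> real"
  assume Pi: "u \<in> Pi_space s \<Omega>" and nontrivial: "\<not> (AE x in lborel. u x = 0)"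
    and extremal: "(G_norm s u)\<^sup>2 = S_HLM \<mu> s \<Omega> * (HL_norm \<mu> u)\<^sup>2"
  define q where "q = sobolev_exponent TYPE('n)"
  have q: "1 \<le> q" using assms(1) by (simp add: q_def sobolev_exponent_def field_simps)
  have n2: "2 \<le> CARD('n)" using assms(1) by simp
  have u [measurable]: "u \<in> borel_measurable borel"
    and u_Lq: "(\<integral>\<^sup>+x. ennreal (\<bar>u x\<bar> powr q) \<partial>lborel) < \<infinity>"
    using Pi unfolding Pi_space_def q_def by simp_all
  from Pi obtain \<phi> where \<phi>: "\<And>k. \<phi> k \<in> test_functions \<Omega>"
    and Cauchy: "\<forall>\<epsilon>>0. \<exists>N. \<forall>j\<ge>N. \<forall>k\<ge>N. G_norm s (\<lambda>x. \<phi> j x - \<phi> k x) < \<epsilon>"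
    and lim: "(\<lambda>k. \<integral>\<^sup>+x. ennreal (\<bar>\<phi> k x - u x\<bar> powr q) \<partial>lborel) \<longlonglongrightarrow> 0"
    unfolding Pi_space_def q_def by auto
  have [measurable]: "\<phi> k \<in> borel_measurable borel" for k using \<phi> by (rule test_borel)
  \<comment> \<open>The full energy dominates its Dirichlet part.\<close>
  have Cauchy': "\<exists>N. \<forall>j\<ge>N. \<forall>k\<ge>N. dirichlet_sq (\<lambda>x. \<phi> j x - \<phi> k x) \<le> ennreal e" if e: "0 < e" for e
  proof -
    have "0 < ennreal (sqrt e)" using e by simp
    with Cauchy obtain N where N: "\<forall>j\<ge>N. \<forall>k\<ge>N. G_norm s (\<lambda>x. \<phi> j x - \<phi> k x) < ennreal (sqrt e)"
      by (elim allE impE) auto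
    have "dirichlet_sq (\<lambda>x. \<phi> j x - \<phi> k x) \<le> ennreal e" if "N \<le> j" "N \<le> k" for j k
    proof -
      have "dirichlet_sq (\<lambda>x. \<phi> j x - \<phi> k x) \<le> (G_norm s (\<lambda>x. \<phi> j x - \<phi> k x))\<^sup>2"
        unfolding G_norm_squared by simp
      also have "\<dots> \<le> (ennreal (sqrt e))\<^sup>2"
        using N that by (intro power_mono[OF less_imp_le]) simp_all
      also have "\<dots> = ennreal e" using e by (simp add: ennreal_power)
      finally show ?thesis .
    qed
    then show ?thesis by blast
  qed
  obtain g where g [measurable]: "g \<in> borel_measurable borel" and weak: "is_weak_gradient u g"
    and g_L2: "(\<integral>\<^sup>+x. ennreal ((norm (g x))\<^sup>2) \<partial>lborel) < \<infinity>"
    and g_lim: "(\<lambda>k. \<integral>\<^sup>+x. ennreal ((norm (g x - grad (\<phi> k) x))\<^sup>2) \<partial>lborel) \<longlonglongrightarrow> 0"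
    by (rule weak_gradient_of_limit[OF u q u_Lq \<phi> Cauchy' lim]) (assumption, rule that)
  have D: "dirichlet_sq u = (\<integral>\<^sup>+x. ennreal ((norm (g x))\<^sup>2) \<partial>lborel)"
    by (rule dirichlet_sq_eq[OF weak])
  obtain r :: "nat \<Rightarrow> nat" where r: "strict_mono r" "AE x in lborel. (\<lambda>k. \<bar>\<phi> (r k) x - u x\<bar> powr q) \<longlonglongrightarrow> 0"
    by (rule nn_integral_tendsto_0_AE_subseq[OF _ _ lim]) (simp, simp, rule that)
  have lim_AE: "AE x in lborel. (\<lambda>k. \<phi> (r k) x) \<longlonglongrightarrow> u x"
    using r(2)
  proof (rule AE_mp, intro AE_I2 impI)
    fix x assume "(\<lambda>k. \<bar>\<phi> (r k) x - u x\<bar> powr q) \<longlonglongrightarrow> 0"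
    then have "(\<lambda>k. (\<bar>\<phi> (r k) x - u x\<bar> powr q) powr (1 / q)) \<longlonglongrightarrow> 0 powr (1 / q)"
      using q by (intro tendsto_powr' tendsto_const) auto
    then have "(\<lambda>k. \<phi> (r k) x - u x) \<longlonglongrightarrow> 0"
      using q by (simp add: powr_powr tendsto_rabs_zero_iff)
    then show "(\<lambda>k. \<phi> (r k) x) \<longlonglongrightarrow> u x" by (simp add: LIM_zero_iff)
  qed
  have p: "0 < HL_exponent TYPE('n) \<mu>"
    using assms(1,3) by (simp add: HL_exponent_def)
  have "S_HLM \<mu> s \<Omega> * (HL_norm \<mu> u)\<^sup>2 \<le> dirichlet_sq u"
  \<comment> \<open>Approximation gives the bound only for constants strictly above \<open>D(u)\<close>.\<close>
  proof (rule dense_ge)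
    fix c assume "dirichlet_sq u < c"
    then have "\<forall>\<^sub>F k in sequentially. (\<integral>\<^sup>+x. ennreal ((norm (grad (\<phi> k) x))\<^sup>2) \<partial>lborel) < c"
      unfolding D using grad_borel[OF \<phi>] by (intro L2_limit_eventually_less[OF _ _ g_lim]) simp_all
    then have ev: "\<forall>\<^sub>F k in sequentially. dirichlet_sq (\<phi> k) < c"
      unfolding dirichlet_sq_test[OF \<phi>] .
    show "S_HLM \<mu> s \<Omega> * (HL_norm \<mu> u)\<^sup>2 \<le> c"
    proof (rule HL_norm_lower_semicontinuous[OF _ p lim_AE])
      show "\<forall>\<^sub>F k in sequentially. S_HLM \<mu> s \<Omega> * (HL_norm \<mu> (\<phi> (r k)))\<^sup>2 \<le> c"
        using eventually_subseq[OF r(1) ev]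
      proof (rule eventually_mono)
        fix k assume "dirichlet_sq (\<phi> (r k)) < c"
        moreover have "S_HLM \<mu> s \<Omega> * (HL_norm \<mu> (\<phi> (r k)))\<^sup>2 \<le> dirichlet_sq (\<phi> (r k))"
          by (rule S_HLM_le_dirichlet[OF assms(1,4,5,3,6,7) test_functions_mono[OF \<phi>]])
        ultimately show "S_HLM \<mu> s \<Omega> * (HL_norm \<mu> (\<phi> (r k)))\<^sup>2 \<le> c" by simp
      qed
    qed simp
  qed
  \<comment> \<open>Finiteness of \<open>D(u)\<close> allows it to be cancelled.\<close>
  then have "dirichlet_sq u + gagliardo_sq s u \<le> dirichlet_sq u"
    using extremal unfolding G_norm_squared by simp
  moreover have "dirichlet_sq u < \<infinity>" unfolding D by (rule g_L2)
  ultimately have "gagliardo_sq s u = 0"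
    by (cases "dirichlet_sq u"; cases "gagliardo_sq s u") (auto simp: top_unique simp flip: ennreal_plus)
  then obtain b where b: "AE x in lborel. u x = b"
    by (rule gagliardo_sq_eq_0_imp_constant[OF n2 assms(4,5) u]) (rule that)
  then have "b = 0" using u_Lq by (rule constant_Lq_eq_0)
  then show False using b nontrivial by simp
qed

end
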